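(* Let $G$ be either Thompson's group $F$, $T$ or $V$ with its usual action on $\mathcal{X}$, where $\mathcal{X}$ is $(0,1)$, $S^1$ or the Cantor space, respectively. Then, for all $x,y\in\mathcal{X}$, there exists a homeomorphism $f\colon\mathcal{X}\rightarrow\mathcal{X}$ such that $f\,\mathrm{St}_G^0(x)\,f^{-1}=\mathrm{St}_G^0(y)$.
   Context: For a group $G$ of homeomorphisms of $\mathcal{X}$ and $x\in\mathcal{X}$, the neighbourhood stabiliser $\mathrm{St}_G^0(x)$ is the subgroup of all $g\in G$ with $g(x)=x$ whose set of fixed points contains an open neighbourhood of $x$. Thompson's groups: - $F$ is the group of all orientation-preserving piecewise linear homeomorphisms of $[0,1]$ with finitely many breakpoints, all of which are dyadic rationals, and whose slopes are all integer powers of $2$; it acts on $(0,1)$ by restriction. - $T$ is the group of all orientation-preserving piecewise linear homeomorphisms of $S^1=\mathbb{R}/\mathbb{Z}$ which map images of dyadic rationals to images of dyadic rationals, have finitely many breakpoints, all at images of dyadic rationals, and whose slopes are all integer powers of $2$. - $V$ is the group of all homeomorphisms of the Cantor space $\{0,1\}^{\mathbb{N}}$ of the following form: there are finite words $u_1,\dots,u_n$ and $v_1,\dots,v_n$ over $\{0,1\}$ such that the cylinders $u_i\{0,1\}^{\mathbb{N}}$ partition $\{0,1\}^{\mathbb{N}}$, the cylinders $v_i\{0,1\}^{\mathbb{N}}$ partition $\{0,1\}^{\mathbb{N}}$, and the homeomorphism maps $u_iw$ to $v_iw$ for every $i$ and every $w\in\{0,1\}^{\mathbb{N}}$. *)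

theory Defs
  imports "HOL-Analysis.Analysis" "HOL-Library.Omega_Words_Fun"
begin

section \<open>Groups of homeomorphisms\<close>

text \<open>
  A group of homeomorphisms of a space \<open>X\<close> is given by its set \<open>G\<close> of elements. They are
  maps in \<open>extensional (topspace X)\<close>, so that equality of elements is equality of maps on
  the points of \<open>X\<close>.
\<close>

definition nbhd_stabiliser :: "'a topology \<Rightarrow> ('a \<Rightarrow> 'a) set \<Rightarrow> 'a \<Rightarrow> ('a \<Rightarrow> 'a) set" where
  "nbhd_stabiliser X G x =
     {g \<in> G. g x = x \<and> (\<exists>U. openin X U \<and> x \<in> U \<and> (\<forall>z\<in>U. g z = z))}"

definition conjugate_by :: "'a topology \<Rightarrow> ('a \<Rightarrow> 'a) \<Rightarrow> ('a \<Rightarrow> 'a) set \<Rightarrow> ('a \<Rightarrow> 'a) set" where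
  "conjugate_by X f A =
     (\<lambda>g. restrict (f \<circ> g \<circ> inv_into (topspace X) f) (topspace X)) ` A"


section \<open>Dyadic piecewise linear maps\<close>

text \<open>The library's \<^const>\<open>dyadics\<close> contains only the nonnegative dyadic rationals.\<close>

definition dyadic_rationals :: "real set" where
  "dyadic_rationals = {of_int m / 2 ^ k | (m :: int) (k :: nat). True}"

text \<open>
  The points \<open>p 0, \<dots>, p n\<close> form a subdivision of \<open>[a, b]\<close> containing all breakpoints; not
  every one of them has to be a breakpoint.
\<close>

definition dyadic_pl :: "real \<Rightarrow> real \<Rightarrow> (real \<Rightarrow> real) \<Rightarrow> bool" where
  "dyadic_pl a b h \<longleftrightarrow>
     (\<exists>(n :: nat) (p :: nat \<Rightarrow> real). p 0 = a \<and> p n = b \<and>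
        (\<forall>i\<le>n. p i \<in> dyadic_rationals) \<and>
        (\<forall>i<n. p i < p (Suc i) \<and>
          (\<exists>(k :: int) c. \<forall>t\<in>{p i..p (Suc i)}. h t = 2 powi k * t + c)))"


section \<open>Thompson's group \<open>F\<close>\<close>

definition thompson_F :: "(real \<Rightarrow> real) set" where
  "thompson_F = {restrict h {0<..<1} | h.
     homeomorphic_map (top_of_set {0..1}) (top_of_set {0..1}) h \<and>
     strict_mono_on {0..1} h \<and> dyadic_pl 0 1 h}"


section \<open>The circle \<open>\<real>/\<int>\<close> and Thompson's group \<open>T\<close>\<close>

definition circle_proj :: "real \<Rightarrow> real set" where
  "circle_proj t = {t + of_int k | k :: int. True}"

definition circle :: "real set topology" where
  "circle = topology (\<lambda>U. U \<subseteq> range circle_proj \<and> open (circle_proj -` U))"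

lemma circle_proj_eq_iff: "circle_proj s = circle_proj t \<longleftrightarrow> s - t \<in> \<int>"
proof
  assume "circle_proj s = circle_proj t"
  moreover have "s \<in> circle_proj s"
    unfolding circle_proj_def by (auto intro!: exI[of _ 0])
  ultimately obtain k :: int where "s = t + of_int k"
    unfolding circle_proj_def by auto
  then show "s - t \<in> \<int>" by simp
next
  assume "s - t \<in> \<int>"
  then obtain k :: int where "s - t = of_int k" by (auto elim: Ints_cases)
  then have s: "s = t + of_int k" by simp
  have "s + of_int j = t + of_int (k + j)" "t + of_int j = s + of_int (j - k)" for j
    by (simp_all add: s)
  then show "circle_proj s = circle_proj t"
    unfolding circle_proj_def by blast
qed

lemma openin_circle:
  "openin circle U \<longleftrightarrow> U \<subseteq> range circle_proj \<and> open (circle_proj -` U)"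
proof -
  have "istopology (\<lambda>U. U \<subseteq> range circle_proj \<and> open (circle_proj -` U))"
    unfolding istopology_def by (auto simp: vimage_Int vimage_Union intro!: open_Int open_UN)
  then show ?thesis
    by (simp add: circle_def topology_inverse')
qed

lemma topspace_circle: "topspace circle = range circle_proj"
proof -
  have "openin circle (range circle_proj)"
    by (simp add: openin_circle vimage_def)
  then show ?thesis
    by (metis openin_circle openin_subset openin_topspace subset_antisym)
qed

lemma quotient_map_circle_proj: "quotient_map euclidean circle circle_proj"
  unfolding quotient_map_def topspace_circle by (auto simp: openin_circle vimage_def)

text \<open>
  A homeomorphism of \<open>\<real>/\<int>\<close> preserves the orientation iff it has an increasing lift \<open>h\<close> to
  \<open>\<real>\<close> which commutes with the translation by 1. Breakpoints and slopes are those of the lift.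
\<close>

definition orientation_preserving_lift :: "(real set \<Rightarrow> real set) \<Rightarrow> (real \<Rightarrow> real) \<Rightarrow> bool" where
  "orientation_preserving_lift g h \<longleftrightarrow>
     continuous_on UNIV h \<and> strict_mono h \<and> (\<forall>t. h (t + 1) = h t + 1) \<and>
     (\<forall>t. g (circle_proj t) = circle_proj (h t))"

definition thompson_T :: "(real set \<Rightarrow> real set) set" where
  "thompson_T = {g \<in> extensional (topspace circle).
     homeomorphic_map circle circle g \<and>
     g ` circle_proj ` dyadic_rationals \<subseteq> circle_proj ` dyadic_rationals \<and>
     (\<exists>h. orientation_preserving_lift g h \<and> dyadic_pl 0 1 h)}"


section \<open>The Cantor space and Thompson's group \<open>V\<close>\<close>

text \<open>
  The type \<^typ>\<open>nat \<Rightarrow> bool\<close> carries the product of the discrete topologies as its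
  \<^const>\<open>euclidean\<close> topology.
\<close>

abbreviation cantor_space :: "(nat \<Rightarrow> bool) topology" where
  "cantor_space \<equiv> euclidean"

definition cylinder :: "bool list \<Rightarrow> (nat \<Rightarrow> bool) set" where
  "cylinder u = range (\<lambda>w. u \<frown> w)"

definition cylinder_partition :: "nat \<Rightarrow> (nat \<Rightarrow> bool list) \<Rightarrow> bool" where
  "cylinder_partition n u \<longleftrightarrow>
     disjoint_family_on (\<lambda>i. cylinder (u i)) {..<n} \<and> (\<Union>i<n. cylinder (u i)) = UNIV"

definition thompson_V :: "((nat \<Rightarrow> bool) \<Rightarrow> (nat \<Rightarrow> bool)) set" where
  "thompson_V = {g. homeomorphic_map cantor_space cantor_space g \<and>
     (\<exists>n u v. cylinder_partition n u \<and> cylinder_partition n v \<and>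
       (\<forall>i<n. \<forall>w. g (u i \<frown> w) = v i \<frown> w))}"

end

theory Submission
  imports Defs
begin

text \<open>
  Membership in each of the three groups is a local condition: near every point an element acts by
  prefix replacement (for \<open>V\<close>), respectively its lift to the line is affine on both sides, with slope
  a power of 2, and breaks only at dyadic points (for \<open>F\<close> and \<open>T\<close>). Hence it is enough to find a
  homeomorphism \<open>f\<close> with \<open>f x = y\<close> that satisfies this condition off \<open>x\<close>: the conjugate by \<open>f\<close> of an
  element that is trivial near \<open>x\<close> satisfies the condition off \<open>y\<close>, and is trivial near \<open>y\<close>.
  For \<open>V\<close> such an \<open>f\<close> maps the cylinders branching off \<open>x\<close> to those branching off \<open>y\<close>; for \<open>F\<close> and \<open>T\<close> it
  matches the intervals of length \<open>2\<^sup>k\<close> cut out by infinite binary expansions of \<open>x\<close> and \<open>y\<close>.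
\<close>

section \<open>Conjugating neighbourhood stabilisers\<close>

text \<open>In general \<open>f\<close> cannot come from the group: elements of F and T preserve
  dyadic rationals, and elements of V preserve the tails of words, so the groups have many orbits.
  For points of different orbits, \<open>f\<close> therefore has to violate the local condition at
  \<open>x\<close> itself; the construction confines the failure to that point (for T, to its
  translates on the line), where infinitely many pieces accumulate. This does no harm. An element of
  the stabiliser is injective and fixes \<open>x\<close>, hence moves no other point to
  \<open>x\<close>, so away from \<open>y\<close> every factor of the conjugate is applied where it
  is good; at \<open>y\<close> the infinitely many pieces cancel because the element is trivial near
  \<open>x\<close>. Compactness, of the Cantor space or of [0,1], turns the local condition back
  into a finite description. For F and T all local work takes place on the real line: elements of F
  are extended by the identity and elements of T are lifted, so that neither endpoints nor the
  circle need a calculus of their own. The expansions are infinite even for dyadic points, so that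
  the pieces for \<open>x\<close> and \<open>y\<close> correspond one to one.\<close>

lemma nbhd_stabiliser_conjugate:
  assumes f: "homeomorphic_maps X X f f'" and x: "x \<in> topspace X" "f x = y"
    and g: "g \<in> nbhd_stabiliser X G x"
    and conj: "restrict (f \<circ> g \<circ> f') (topspace X) \<in> G"
  shows "restrict (f \<circ> g \<circ> f') (topspace X) \<in> nbhd_stabiliser X G y"
proof -
  obtain U where U: "openin X U" "x \<in> U" "\<And>z. z \<in> U \<Longrightarrow> g z = z" and gx: "g x = x"
    using g by (auto simp: nbhd_stabiliser_def)
  have hom: "homeomorphic_map X X f" and f'f: "\<And>z. z \<in> topspace X \<Longrightarrow> f' (f z) = z"
    and ff: "\<And>z. z \<in> topspace X \<Longrightarrow> f z \<in> topspace X"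
    using f by (auto simp: homeomorphic_maps_map dest: homeomorphic_imp_surjective_map)
  have "openin X (f ` U)" "y \<in> f ` U"
    using hom U x homeomorphic_map_openness_eq by blast+
  moreover have "restrict (f \<circ> g \<circ> f') (topspace X) z = z" if "z \<in> f ` U" for z
    using that U ff f'f openin_subset[OF U(1)] by auto
  ultimately show ?thesis
    using conj unfolding nbhd_stabiliser_def by blast
qed

text \<open>Two inclusions, one from conjugating with \<open>f\<close> and one with
  \<open>f'\<close>. Conjugates are required to lie in \<open>G\<close> only for elements of the
  stabilisers, because the maps used below need not normalise the group.\<close>

lemma conjugate_by_nbhd_stabiliser:
  assumes f: "homeomorphic_maps X X f f'" and x: "x \<in> topspace X" "f x = y"
    and ext: "G \<subseteq> extensional (topspace X)"
    and maps: "\<And>g. g \<in> G \<Longrightarrow> g ` topspace X \<subseteq> topspace X"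
    and fwd: "\<And>g. g \<in> nbhd_stabiliser X G x \<Longrightarrow> restrict (f \<circ> g \<circ> f') (topspace X) \<in> G"
    and bwd: "\<And>g. g \<in> nbhd_stabiliser X G y \<Longrightarrow> restrict (f' \<circ> g \<circ> f) (topspace X) \<in> G"
  shows "conjugate_by X f (nbhd_stabiliser X G x) = nbhd_stabiliser X G y"
proof -
  have hom: "homeomorphic_map X X f" and f'f: "\<And>z. z \<in> topspace X \<Longrightarrow> f' (f z) = z"
    and ff': "\<And>z. z \<in> topspace X \<Longrightarrow> f (f' z) = z"
    and fX: "\<And>z. z \<in> topspace X \<Longrightarrow> f z \<in> topspace X"
    and f'X: "\<And>z. z \<in> topspace X \<Longrightarrow> f' z \<in> topspace X"
    using f by (auto simp: homeomorphic_maps_map dest: homeomorphic_imp_surjective_map)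
  have inv: "inv_into (topspace X) f z = f' z" if "z \<in> topspace X" for z
    using that by (metis f'X f'f ff' hom homeomorphic_imp_injective_map inv_into_f_f)
  have conj: "restrict (f \<circ> g \<circ> inv_into (topspace X) f) (topspace X) =
      restrict (f \<circ> g \<circ> f') (topspace X)" for g
    by (rule restrict_ext) (simp add: inv)
  have f': "homeomorphic_maps X X f' f"
    using f homeomorphic_maps_sym by metis
  have y: "y \<in> topspace X" "f' y = x"
    using x fX f'f by auto
  show ?thesis
    unfolding conjugate_by_def conj
  proof (intro equalityI subsetI)
    fix h assume "h \<in> (\<lambda>g. restrict (f \<circ> g \<circ> f') (topspace X)) ` nbhd_stabiliser X G x"
    then show "h \<in> nbhd_stabiliser X G y"
      using nbhd_stabiliser_conjugate[OF f x] fwd by blast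
  next
    fix h assume h: "h \<in> nbhd_stabiliser X G y"
    then have hG: "h \<in> G" by (simp add: nbhd_stabiliser_def)
    let ?g = "restrict (f' \<circ> h \<circ> f) (topspace X)"
    have "?g \<in> nbhd_stabiliser X G x"
      using nbhd_stabiliser_conjugate[OF f' y h] bwd[OF h] by blast
    moreover have "restrict (f \<circ> ?g \<circ> f') (topspace X) = h"
    proof (rule extensionalityI[of _ "topspace X"])
      show "h \<in> extensional (topspace X)" using ext hG by blast
      show "restrict (f \<circ> ?g \<circ> f') (topspace X) z = h z" if "z \<in> topspace X" for z
        using that maps[OF hG] f'X ff' by (auto simp: image_subset_iff)
    qed simp
    ultimately show "h \<in> (\<lambda>g. restrict (f \<circ> g \<circ> f') (topspace X)) ` nbhd_stabiliser X G x"
      by (metis (no_types, lifting) image_eqI)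
  qed
qed


section \<open>Thompson's group \<open>V\<close>\<close>

text \<open>The definition of V read at one point: the words may vary with the point, and
  \<open>locally_prefix_replacing_uniform\<close> makes their number finite again.\<close>

definition locally_prefix_replacing :: "((nat \<Rightarrow> bool) \<Rightarrow> nat \<Rightarrow> bool) \<Rightarrow> (nat \<Rightarrow> bool) \<Rightarrow> bool" where
  "locally_prefix_replacing g z \<longleftrightarrow> (\<exists>m v. \<forall>w. g (prefix m z \<frown> w) = v \<frown> w)"

section \<open>Prefixes, cylinders and the topology of the Cantor space\<close>

lemma prefix_append_subsequence: "m \<le> n \<Longrightarrow> prefix n z = prefix m z @ subsequence z m n"
  using subsequence_append[of z m "n - m"] by simp

lemma prefix_eq_iff: "prefix n z = prefix n z' \<longleftrightarrow> (\<forall>i<n. z i = z' i)"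
  by (auto simp: subsequence_def)

lemma mem_cylinder_iff: "z \<in> cylinder u \<longleftrightarrow> prefix (length u) z = u"
proof
  assume "z \<in> cylinder u"
  then show "prefix (length u) z = u" by (auto simp: cylinder_def)
next
  assume "prefix (length u) z = u"
  then have "z = u \<frown> suffix (length u) z"
    using prefix_suffix[of z "length u"] by simp
  then show "z \<in> cylinder u" by (auto simp: cylinder_def)
qed

lemma open_prefix_eq: "open {z' :: nat \<Rightarrow> bool. prefix n z' = prefix n z}"
proof -
  have "open {z' :: nat \<Rightarrow> bool. \<forall>i\<in>{..<n}. z' (id i) \<in> {z i}}"
    by (intro product_topology_basis') (auto intro: open_discrete)
  also have "{z' :: nat \<Rightarrow> bool. \<forall>i\<in>{..<n}. z' (id i) \<in> {z i}} = {z'. prefix n z' = prefix n z}"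
    by (auto simp: prefix_eq_iff)
  finally show ?thesis .
qed

lemma open_contains_prefix_eq:
  fixes U :: "(nat \<Rightarrow> bool) set"
  assumes "open U" "z \<in> U"
  obtains n where "\<And>z'. prefix n z' = prefix n z \<Longrightarrow> z' \<in> U"
proof -
  have "openin (product_topology (\<lambda>i. euclidean) UNIV) U"
    using assms by (simp add: euclidean_product_topology)
  then obtain Y where Y: "finite {i. Y i \<noteq> (UNIV :: bool set)}" "z \<in> Pi\<^sub>E UNIV Y" "Pi\<^sub>E UNIV Y \<subseteq> U"
    using assms(2) unfolding openin_product_topology_alt by force
  obtain n where n: "{i. Y i \<noteq> UNIV} \<subseteq> {..<n}"
    using Y(1) finite_nat_iff_bounded by blast
  show thesis
  proof
    fix z' assume z': "prefix n z' = prefix n z"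
    have "z' i \<in> Y i" for i
      using n z' Y(2) by (cases "Y i = UNIV") (auto simp: prefix_eq_iff PiE_iff subset_iff)
    then show "z' \<in> U" using Y(3) by (auto simp: PiE_iff)
  qed
qed

section \<open>Lengthening, composing and making uniform the replaced prefixes\<close>

lemma locally_prefix_replacing_mono:
  assumes "\<And>w. g (prefix m z \<frown> w) = v \<frown> w" "m \<le> n"
  shows "g (prefix n z \<frown> w) = (v @ subsequence z m n) \<frown> w"
proof -
  have "prefix n z \<frown> w = prefix m z \<frown> (subsequence z m n \<frown> w)"
    using assms(2) by (simp add: prefix_append_subsequence)
  then show ?thesis using assms(1) by (simp del: conc_conc add: conc_conc[symmetric])
qed

lemma locally_prefix_replacing_comp:
  assumes "locally_prefix_replacing g z" "locally_prefix_replacing h (g z)"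
  shows "locally_prefix_replacing (h \<circ> g) z"
proof -
  obtain m v where g: "\<And>w. g (prefix m z \<frown> w) = v \<frown> w"
    using assms(1) by (auto simp: locally_prefix_replacing_def)
  obtain k v2 where h: "\<And>w. h (prefix k (g z) \<frown> w) = v2 \<frown> w"
    using assms(2) by (auto simp: locally_prefix_replacing_def)
  \<comment> \<open>Taking \<open>k\<close> more letters of \<open>z\<close> makes the image word at
    least \<open>k\<close> letters long, so that the replacement performed by \<open>h\<close>
    applies to it.\<close>
  have gn: "\<And>w. g (prefix (m + k) z \<frown> w) = (v @ subsequence z m (m + k)) \<frown> w"
    using locally_prefix_replacing_mono[OF g] by simp
  let ?v = "v @ subsequence z m (m + k)"
  have gz: "g z = ?v \<frown> suffix (m + k) z"
    using gn[of "suffix (m + k) z"] prefix_suffix[of z] by metis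
  then have v: "prefix (length ?v) (g z) = ?v"
    by (simp del: conc_conc)
  have "h (?v \<frown> w) = (v2 @ subsequence (g z) k (length ?v)) \<frown> w" for w
    using locally_prefix_replacing_mono[OF h, of "length ?v"] v by simp
  then have "\<forall>w. (h \<circ> g) (prefix (m + k) z \<frown> w) = (v2 @ subsequence (g z) k (length ?v)) \<frown> w"
    using gn by simp
  then show ?thesis unfolding locally_prefix_replacing_def by blast
qed

lemma compact_cantor_space: "compact (UNIV :: (nat \<Rightarrow> bool) set)"
proof -
  have "compact_space (product_topology (\<lambda>i::nat. euclidean :: bool topology) UNIV)"
    unfolding compact_space_product_topology
    by (auto simp: compact_space_def intro!: finite_imp_compact)
  then show ?thesis
    by (simp add: euclidean_product_topology compact_space_def)
qed

text \<open>Finitely many of the cylinders provided by the local condition cover the compact space;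
  the longest of their prefixes serves everywhere, since prefixes may be lengthened.\<close>

lemma locally_prefix_replacing_uniform:
  assumes "\<And>z. locally_prefix_replacing g z"
  obtains N where "\<And>z. \<exists>v. \<forall>w. g (prefix N z \<frown> w) = v \<frown> w"
proof -
  have "\<forall>z. \<exists>m v. \<forall>w. g (prefix m z \<frown> w) = v \<frown> w"
    using assms unfolding locally_prefix_replacing_def by blast
  from choice[OF this] obtain m where "\<forall>z. \<exists>v. \<forall>w. g (prefix (m z) z \<frown> w) = v \<frown> w" ..
  from choice[OF this] obtain v where "\<forall>z w. g (prefix (m z) z \<frown> w) = v z \<frown> w" ..
  then have g: "g (prefix (m z) z \<frown> w) = v z \<frown> w" for z w
    by simp
  obtain C where C: "finite C" "UNIV \<subseteq> (\<Union>z\<in>C. {z'. prefix (m z) z' = prefix (m z) z})"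
  proof (rule compactE_image[OF compact_cantor_space])
    show "open {z'. prefix (m z) z' = prefix (m z) z}" for z by (rule open_prefix_eq)
    show "UNIV \<subseteq> (\<Union>z. {z'. prefix (m z) z' = prefix (m z) z})" by blast
  qed
  have "\<exists>v. \<forall>w. g (prefix (Max (m ` C)) z \<frown> w) = v \<frown> w" for z
  proof -
    obtain c where c: "c \<in> C" "prefix (m c) z = prefix (m c) c" using C by blast
    have "m c \<le> Max (m ` C)" using C c by simp
    moreover have "\<And>w. g (prefix (m c) z \<frown> w) = v c \<frown> w" using g[of c] c by simp
    ultimately show ?thesis using locally_prefix_replacing_mono by blast
  qed
  then show thesis using that by blast
qed

text \<open>For the harder inclusion the source partition consists of all words of one uniform
  length \<open>N\<close>. The target words then give a partition because \<open>g\<close> is a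
  bijection that carries each source cylinder onto its target cylinder.\<close>

lemma thompson_V_eq:
  "thompson_V = {g. homeomorphic_map cantor_space cantor_space g \<and> (\<forall>z. locally_prefix_replacing g z)}"
proof (intro equalityI subsetI CollectI conjI allI)
  fix g assume g: "g \<in> thompson_V"
  then show "homeomorphic_map cantor_space cantor_space g" by (simp add: thompson_V_def)
  fix z
  obtain n u v where uv: "cylinder_partition n u" "\<And>i w. i < n \<Longrightarrow> g (u i \<frown> w) = v i \<frown> w"
    using g by (auto simp: thompson_V_def)
  then obtain i where i: "i < n" "z \<in> cylinder (u i)"
    unfolding cylinder_partition_def by blast
  then show "locally_prefix_replacing g z"
    using uv(2)[of i] unfolding locally_prefix_replacing_def mem_cylinder_iff by metis
next
  fix g assume g: "g \<in> {g. homeomorphic_map cantor_space cantor_space g \<and>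
    (\<forall>z. locally_prefix_replacing g z)}"
  then have inj: "inj g" and surj: "surj g"
    using homeomorphic_imp_injective_map homeomorphic_imp_surjective_map by fastforce+
  obtain N where N: "\<And>z. \<exists>v. \<forall>w. g (prefix N z \<frown> w) = v \<frown> w"
    using locally_prefix_replacing_uniform g by blast
  \<comment> \<open>Any infinite continuation of \<open>u\<close> will do, since only its first
    \<open>N\<close> letters enter.\<close>
  have N': "\<exists>v. \<forall>w. g (u \<frown> w) = v \<frown> w" if "length u = N" for u
    using N[of "u \<frown> undefined"] that by auto
  have "finite {u :: bool list. length u = N}"
    using finite_lists_length_eq[of "UNIV :: bool set" N] by (simp add: finite)
  then obtain u n where u: "bij_betw u {..<n::nat} {u :: bool list. length u = N}"
    using ex_bij_betw_nat_finite lessThan_atLeast0 by metis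
  have len: "length (u i) = N" if "i < n" for i
    using u that by (auto simp: bij_betw_def)
  then have "\<forall>i. \<exists>v. i < n \<longrightarrow> (\<forall>w. g (u i \<frown> w) = v \<frown> w)"
    using N' by blast
  from choice[OF this] obtain v where "\<forall>i. i < n \<longrightarrow> (\<forall>w. g (u i \<frown> w) = v i \<frown> w)" ..
  then have v: "g (u i \<frown> w) = v i \<frown> w" if "i < n" for i w
    using that by simp
  have disj: "disjoint_family_on (\<lambda>i. cylinder (u i)) {..<n}"
    unfolding disjoint_family_on_def
  proof (intro ballI impI)
    fix i j assume ij: "i \<in> {..<n}" "j \<in> {..<n}" "i \<noteq> j"
    then have "u i \<noteq> u j" using u by (auto simp: bij_betw_def inj_on_def)
    then show "cylinder (u i) \<inter> cylinder (u j) = {}"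
      using ij len by (auto simp: mem_cylinder_iff)
  qed
  have cover: "(\<Union>i<n. cylinder (u i)) = UNIV"
  proof -
    have "z \<in> (\<Union>i<n. cylinder (u i))" for z
    proof -
      have "prefix N z \<in> u ` {..<n}" using u by (simp add: bij_betw_def)
      then show ?thesis using len by (force simp: mem_cylinder_iff)
    qed
    then show ?thesis by blast
  qed
  have img: "cylinder (v i) = g ` cylinder (u i)" if "i < n" for i
    using v[OF that] by (simp add: cylinder_def image_image)
  have "cylinder_partition n v"
    unfolding cylinder_partition_def disjoint_family_on_def
  proof (intro conjI ballI impI)
    fix i j assume ij: "i \<in> {..<n}" "j \<in> {..<n}" "i \<noteq> j"
    then have "cylinder (u i) \<inter> cylinder (u j) = {}"
      using disj by (auto simp: disjoint_family_on_def)
    then have "g ` cylinder (u i) \<inter> g ` cylinder (u j) = {}"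
      using image_Int[OF inj] by (metis image_empty)
    then show "cylinder (v i) \<inter> cylinder (v j) = {}"
      using img ij by simp
  next
    have "(\<Union>i<n. cylinder (v i)) = g ` (\<Union>i<n. cylinder (u i))"
      using img by auto
    then show "(\<Union>i<n. cylinder (v i)) = UNIV" using cover surj by simp
  qed
  then show "g \<in> thompson_V"
    using g v disj cover unfolding thompson_V_def cylinder_partition_def by blast
qed

text \<open>
  Maps \<open>x\<close> to \<open>y\<close> and, for each \<open>n\<close>, the cylinder of the words that leave \<open>x\<close> at position \<open>n\<close> onto
  the cylinder of the words that leave \<open>y\<close> there, by prefix replacement.
\<close>

definition branch_swap :: "(nat \<Rightarrow> bool) \<Rightarrow> (nat \<Rightarrow> bool) \<Rightarrow> (nat \<Rightarrow> bool) \<Rightarrow> nat \<Rightarrow> bool" where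
  "branch_swap x y z =
     (\<lambda>i. if \<forall>j<i. z j = x j then (z i = x i) = y i else z i)"

lemma branch_swap_self: "branch_swap x y x = y"
  by (auto simp: branch_swap_def)

text \<open>As an equation between truth values, \<open>(z i = x i) = y i\<close> has the value
  \<open>y i\<close> exactly when \<open>z i = x i\<close>. So the image leaves \<open>y\<close> at
  the position where \<open>z\<close> leaves \<open>x\<close>.\<close>

lemma branch_swap_agree: "(\<forall>j<i. branch_swap x y z j = y j) \<longleftrightarrow> (\<forall>j<i. z j = x j)"
proof (induction i)
  case (Suc i)
  have "(\<forall>j<Suc i. branch_swap x y z j = y j) \<longleftrightarrow> (\<forall>j<i. z j = x j) \<and> branch_swap x y z i = y i"
    using Suc by (auto simp: less_Suc_eq)
  also have "\<dots> \<longleftrightarrow> (\<forall>j<Suc i. z j = x j)"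
    by (auto simp: less_Suc_eq branch_swap_def)
  finally show ?case .
qed simp

text \<open>By \<open>branch_swap_agree\<close> both maps change letters at the same positions, and
  there equality of truth values is associative and cancels.\<close>

lemma branch_swap_inverse: "branch_swap y x (branch_swap x y z) = z"
proof
  fix i
  show "branch_swap y x (branch_swap x y z) i = z i"
    using branch_swap_agree[of i x y z] by (auto simp: branch_swap_def[of y x] branch_swap_def[of x y z])
qed

text \<open>A prefix that contains a letter different from that of \<open>x\<close> decides
  everything: all later letters are copied.\<close>

lemma locally_prefix_replacing_branch_swap:
  assumes "z \<noteq> x"
  shows "locally_prefix_replacing (branch_swap x y) z"
proof -
  obtain n where n: "z n \<noteq> x n" using assms by auto
  have "branch_swap x y (prefix (Suc n) z \<frown> w) = prefix (Suc n) (branch_swap x y z) \<frown> w" for w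
  proof
    fix i
    have eq: "(prefix (Suc n) z' \<frown> w) j = z' j" if "j \<le> n" for z' j
      using that by (simp add: conc_def subsequence_def del: upt_Suc)
    show "branch_swap x y (prefix (Suc n) z \<frown> w) i = (prefix (Suc n) (branch_swap x y z) \<frown> w) i"
    proof (cases "i \<le> n")
      case True
      then show ?thesis by (auto simp: branch_swap_def eq simp del: subseq_to_Suc)
    next
      case False
      then have "\<not> (\<forall>j<i. (prefix (Suc n) z \<frown> w) j = x j)"
        using n eq[of n] by (metis le_refl not_le)
      then have "branch_swap x y (prefix (Suc n) z \<frown> w) i = (prefix (Suc n) z \<frown> w) i"
        unfolding branch_swap_def by (rule if_not_P)
      then show ?thesis using False by (simp del: subseq_to_Suc)
    qed
  qed
  then show ?thesis unfolding locally_prefix_replacing_def by blast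
qed

text \<open>The first \<open>n\<close> letters of the image depend only on the first
  \<open>n\<close> letters of the argument.\<close>

lemma continuous_branch_swap: "continuous_on UNIV (branch_swap x y)"
  unfolding continuous_on_open_vimage[OF open_UNIV]
proof (intro allI impI)
  fix B :: "(nat \<Rightarrow> bool) set" assume B: "open B"
  have "\<exists>T. open T \<and> z \<in> T \<and> T \<subseteq> branch_swap x y -` B" if z: "branch_swap x y z \<in> B" for z
  proof -
    obtain n where n: "\<And>z'. prefix n z' = prefix n (branch_swap x y z) \<Longrightarrow> z' \<in> B"
      using open_contains_prefix_eq[OF B z] by blast
    have "prefix n (branch_swap x y z') = prefix n (branch_swap x y z)"
      if "prefix n z' = prefix n z" for z'
      using that unfolding prefix_eq_iff branch_swap_def by auto
    then have "{z'. prefix n z' = prefix n z} \<subseteq> branch_swap x y -` B"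
      using n by blast
    then show ?thesis
      using open_prefix_eq by (intro exI[of _ "{z'. prefix n z' = prefix n z}"]) blast
  qed
  then have "open (branch_swap x y -` B)"
    by (subst open_subopen) auto
  then show "open (branch_swap x y -` B \<inter> UNIV)" by simp
qed

lemma homeomorphic_maps_branch_swap:
  "homeomorphic_maps cantor_space cantor_space (branch_swap x y) (branch_swap y x)"
  by (auto simp: homeomorphic_maps_def branch_swap_inverse continuous_branch_swap)

lemma thompson_V_branch_swap:
  assumes "g \<in> nbhd_stabiliser cantor_space thompson_V x"
  shows "branch_swap x y \<circ> g \<circ> branch_swap y x \<in> thompson_V"
proof -
  have gV: "homeomorphic_map cantor_space cantor_space g" "\<And>z. locally_prefix_replacing g z"
    and gx: "g x = x" and "\<exists>U. open U \<and> x \<in> U \<and> (\<forall>z\<in>U. g z = z)"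
    using assms by (simp_all add: nbhd_stabiliser_def thompson_V_eq)
  then obtain U where U: "open U" "x \<in> U" "\<And>z. z \<in> U \<Longrightarrow> g z = z"
    by blast
  obtain n where n: "\<And>z'. prefix n z' = prefix n x \<Longrightarrow> z' \<in> U"
    using open_contains_prefix_eq[OF U(1,2)] by blast
  have "homeomorphic_map cantor_space cantor_space (branch_swap x y \<circ> g \<circ> branch_swap y x)"
    by (rule homeomorphic_map_compose[OF homeomorphic_maps_imp_map[OF homeomorphic_maps_branch_swap]
          homeomorphic_map_compose[OF gV(1) homeomorphic_maps_imp_map[OF homeomorphic_maps_branch_swap]]])
  moreover have "locally_prefix_replacing (branch_swap x y \<circ> g \<circ> branch_swap y x) z" for z
  proof (cases "z = y")
    case False
    have "branch_swap y x z \<noteq> x" using False by (metis branch_swap_inverse branch_swap_self)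
    moreover have "inj g" using gV(1) homeomorphic_imp_injective_map by fastforce
    \<comment> \<open>This is where fixing \<open>x\<close> matters: the last factor is again
      applied off its bad point.\<close>
    ultimately have "g (branch_swap y x z) \<noteq> x" using gx by (metis injD)
    then show ?thesis
      by (intro locally_prefix_replacing_comp) (auto simp: False locally_prefix_replacing_branch_swap gV)
  next
    case True
    \<comment> \<open>The cylinder around \<open>y\<close> is carried into the cylinder of the same
      depth around \<open>x\<close>, where \<open>g\<close> is the identity; the two swaps then
      cancel.\<close>
    have "(branch_swap x y \<circ> g \<circ> branch_swap y x) (prefix n y \<frown> w) = prefix n y \<frown> w" for w
    proof -
      have "prefix n (branch_swap y x (prefix n y \<frown> w)) = prefix n x"
        using branch_swap_agree[of n y x] unfolding prefix_eq_iff by simp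
      then have "g (branch_swap y x (prefix n y \<frown> w)) = branch_swap y x (prefix n y \<frown> w)"
        using n U by blast
      then show ?thesis by (simp add: branch_swap_inverse)
    qed
    then show ?thesis using True unfolding locally_prefix_replacing_def by blast
  qed
  ultimately show ?thesis unfolding thompson_V_eq by blast
qed

lemma conjugate_nbhd_stabiliser_V:
  "conjugate_by cantor_space (branch_swap x y) (nbhd_stabiliser cantor_space thompson_V x) =
     nbhd_stabiliser cantor_space thompson_V y"
proof (rule conjugate_by_nbhd_stabiliser[OF homeomorphic_maps_branch_swap])
  show "restrict (branch_swap x y \<circ> g \<circ> branch_swap y x) (topspace cantor_space) \<in> thompson_V"
    if "g \<in> nbhd_stabiliser cantor_space thompson_V x" for g
    using thompson_V_branch_swap[OF that] by (simp add: restrict_UNIV)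
  show "restrict (branch_swap y x \<circ> g \<circ> branch_swap x y) (topspace cantor_space) \<in> thompson_V"
    if "g \<in> nbhd_stabiliser cantor_space thompson_V y" for g
    using thompson_V_branch_swap[OF that] by (simp add: restrict_UNIV)
qed (auto simp: branch_swap_self)


section \<open>Dyadic rationals and local dyadic affinity\<close>

lemma dyadic_rationals_divide_power: "of_int m / 2 ^ k \<in> dyadic_rationals"
  by (auto simp: dyadic_rationals_def)

lemma dyadic_rationals_of_int [simp]: "of_int m \<in> dyadic_rationals"
  using dyadic_rationals_divide_power[of m 0] by simp

lemma dyadic_rationals_0_1 [simp]: "0 \<in> dyadic_rationals" "1 \<in> dyadic_rationals"
  using dyadic_rationals_of_int[of 0] dyadic_rationals_of_int[of 1] by simp_all

lemma dyadic_rationals_powi [simp]: "2 powi k \<in> dyadic_rationals"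
proof (cases "k \<ge> 0")
  case True
  then show ?thesis using dyadic_rationals_of_int[of "2 ^ nat k"] by (simp add: power_int_def)
next
  case False
  then show ?thesis using dyadic_rationals_divide_power[of 1 "nat (-k)"]
    by (simp add: power_int_def field_simps)
qed

lemma dyadic_rationals_add: "s \<in> dyadic_rationals \<Longrightarrow> t \<in> dyadic_rationals \<Longrightarrow> s + t \<in> dyadic_rationals"
proof -
  assume "s \<in> dyadic_rationals" "t \<in> dyadic_rationals"
  then obtain m k n l where "s = of_int m / 2 ^ k" "t = of_int n / 2 ^ l"
    unfolding dyadic_rationals_def by blast
  then have "s + t = of_int (m * 2 ^ l + n * 2 ^ k) / 2 ^ (k + l)"
    by (simp add: add_frac_eq power_add)
  then show ?thesis using dyadic_rationals_divide_power by metis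
qed

lemma dyadic_rationals_mult: "s \<in> dyadic_rationals \<Longrightarrow> t \<in> dyadic_rationals \<Longrightarrow> s * t \<in> dyadic_rationals"
proof -
  assume "s \<in> dyadic_rationals" "t \<in> dyadic_rationals"
  then obtain m k n l where "s = of_int m / 2 ^ k" "t = of_int n / 2 ^ l"
    unfolding dyadic_rationals_def by blast
  then have "s * t = of_int (m * n) / 2 ^ (k + l)"
    by (simp add: power_add)
  then show ?thesis using dyadic_rationals_divide_power by metis
qed

lemma dyadic_rationals_minus: "t \<in> dyadic_rationals \<Longrightarrow> - t \<in> dyadic_rationals"
  using dyadic_rationals_mult[of "-1" t] dyadic_rationals_of_int[of "-1"] by simp

lemma dyadic_rationals_diff: "s \<in> dyadic_rationals \<Longrightarrow> t \<in> dyadic_rationals \<Longrightarrow> s - t \<in> dyadic_rationals"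
  using dyadic_rationals_add[of s "- t"] dyadic_rationals_minus[of t] by simp

lemmas dyadic_rationals_intros =
  dyadic_rationals_add dyadic_rationals_mult dyadic_rationals_minus dyadic_rationals_diff

text \<open>The constant is required to be dyadic so that dyadic and non-dyadic points are both
  preserved; composition needs this to keep breakpoints dyadic.\<close>

definition dyadic_affine_on :: "real set \<Rightarrow> (real \<Rightarrow> real) \<Rightarrow> bool" where
  "dyadic_affine_on S h \<longleftrightarrow> (\<exists>k :: int. \<exists>c\<in>dyadic_rationals. \<forall>t\<in>S. h t = 2 powi k * t + c)"

text \<open>Both closed intervals contain \<open>t\<close>, so the pieces agree there and
  \<open>h\<close> is continuous at \<open>t\<close>. The last clause forbids a break at a
  non-dyadic point.\<close>

definition locally_dyadic :: "(real \<Rightarrow> real) \<Rightarrow> real \<Rightarrow> bool" where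
  "locally_dyadic h t \<longleftrightarrow> (\<exists>e>0. dyadic_affine_on {t - e..t} h \<and> dyadic_affine_on {t..t + e} h \<and>
     (t \<notin> dyadic_rationals \<longrightarrow> dyadic_affine_on {t - e..t + e} h))"

section \<open>Restriction, composition and inversion of affine pieces\<close>

lemma dyadic_affine_onI:
  assumes "c \<in> dyadic_rationals" "\<And>t. t \<in> S \<Longrightarrow> h t = 2 powi (k :: int) * t + c"
  shows "dyadic_affine_on S h"
  using assms unfolding dyadic_affine_on_def by blast

lemma dyadic_affine_on_subset: "dyadic_affine_on S h \<Longrightarrow> T \<subseteq> S \<Longrightarrow> dyadic_affine_on T h"
  unfolding dyadic_affine_on_def by blast

lemma dyadic_affine_on_cong:
  "dyadic_affine_on S h \<Longrightarrow> (\<And>t. t \<in> S \<Longrightarrow> h t = g t) \<Longrightarrow> dyadic_affine_on S g"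
  unfolding dyadic_affine_on_def by fastforce

lemma dyadic_affine_on_translation:
  "c \<in> dyadic_rationals \<Longrightarrow> (\<And>t. t \<in> S \<Longrightarrow> h t = t + c) \<Longrightarrow> dyadic_affine_on S h"
  by (rule dyadic_affine_onI[where k = 0]) auto

text \<open>Powers of 2 are units of the ring of dyadic rationals.\<close>

lemma powi_affine_dyadic_iff:
  assumes "c \<in> dyadic_rationals"
  shows "2 powi k * t + c \<in> dyadic_rationals \<longleftrightarrow> t \<in> dyadic_rationals"
proof
  assume "2 powi k * t + c \<in> dyadic_rationals"
  then have "2 powi (-k) * (2 powi k * t + c - c) \<in> dyadic_rationals"
    by (rule dyadic_rationals_mult[OF dyadic_rationals_powi dyadic_rationals_diff[OF _ assms]])
  moreover have "2 powi (-k) * (2 powi k * t + c - c) = t" by (simp add: power_int_minus)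
  ultimately show "t \<in> dyadic_rationals" by metis
qed (intro dyadic_rationals_intros dyadic_rationals_powi assms)

lemma dyadic_affine_on_dyadic_iff:
  "dyadic_affine_on S h \<Longrightarrow> t \<in> S \<Longrightarrow> h t \<in> dyadic_rationals \<longleftrightarrow> t \<in> dyadic_rationals"
  unfolding dyadic_affine_on_def by (auto simp: powi_affine_dyadic_iff)

lemma dyadic_affine_on_comp:
  assumes f: "dyadic_affine_on S f" and g: "dyadic_affine_on T g" and sub: "f ` S \<subseteq> T"
  shows "dyadic_affine_on S (g \<circ> f)"
proof -
  obtain k c where f: "c \<in> dyadic_rationals" "\<And>t. t \<in> S \<Longrightarrow> f t = 2 powi (k::int) * t + c"
    using f unfolding dyadic_affine_on_def by blast
  obtain l d where g: "d \<in> dyadic_rationals" "\<And>t. t \<in> T \<Longrightarrow> g t = 2 powi (l::int) * t + d"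
    using g unfolding dyadic_affine_on_def by blast
  show ?thesis
  proof (rule dyadic_affine_onI)
    show "2 powi l * c + d \<in> dyadic_rationals"
      by (intro dyadic_rationals_intros dyadic_rationals_powi f g)
    show "(g \<circ> f) t = 2 powi (l + k) * t + (2 powi l * c + d)" if "t \<in> S" for t
    proof -
      have "f t \<in> T" using that sub by blast
      then show ?thesis using that f(2) g(2) by (simp add: power_int_add algebra_simps)
    qed
  qed
qed

lemma dyadic_affine_on_inverse:
  assumes f: "dyadic_affine_on S f" and g: "\<And>t. g (f t) = t"
  shows "dyadic_affine_on (f ` S) g"
proof -
  obtain k c where f: "c \<in> dyadic_rationals" "\<And>t. t \<in> S \<Longrightarrow> f t = 2 powi (k::int) * t + c"
    using f unfolding dyadic_affine_on_def by blast
  show ?thesis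
  proof (rule dyadic_affine_onI)
    show "- (2 powi (-k) * c) \<in> dyadic_rationals"
      by (intro dyadic_rationals_intros dyadic_rationals_powi f)
    show "g u = 2 powi (-k) * u + - (2 powi (-k) * c)" if "u \<in> f ` S" for u
    proof -
      obtain t where t: "t \<in> S" "u = f t" using \<open>u \<in> f ` S\<close> by blast
      have "2 powi (-k) * u + - (2 powi (-k) * c) = 2 powi (-k) * (u - c)"
        by (simp add: algebra_simps)
      also have "\<dots> = 2 powi (-k) * (2 powi k * t)"
        using t f(2) by simp
      also have "\<dots> = t" by (simp add: power_int_minus)
      finally show ?thesis using g t by simp
    qed
  qed
qed

lemma locally_dyadicI_interior:
  assumes "dyadic_affine_on {p..q} h" "p < t" "t < q"
  shows "locally_dyadic h t"
  unfolding locally_dyadic_def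
proof (intro exI[of _ "min (t - p) (q - t)"] conjI impI)
  show "min (t - p) (q - t) > 0" using assms by simp
qed (rule dyadic_affine_on_subset[OF assms(1)]; auto)+

lemma locally_dyadicI_dyadic:
  assumes "dyadic_affine_on {p..t} h" "p < t" "dyadic_affine_on {t..q} h" "t < q" "t \<in> dyadic_rationals"
  shows "locally_dyadic h t"
  unfolding locally_dyadic_def
proof (intro exI[of _ "min (t - p) (q - t)"] conjI impI)
  show "min (t - p) (q - t) > 0" using assms by simp
  show "dyadic_affine_on {t - min (t - p) (q - t)..t} h"
    by (rule dyadic_affine_on_subset[OF assms(1)]) auto
  show "dyadic_affine_on {t..t + min (t - p) (q - t)} h"
    by (rule dyadic_affine_on_subset[OF assms(3)]) auto
qed (use assms in simp)

section \<open>Locality, continuity, composition and inversion of locally dyadic maps\<close>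

lemma locally_dyadic_cong:
  assumes "locally_dyadic f t" "d > 0" "\<And>s. \<bar>s - t\<bar> < d \<Longrightarrow> f s = g s"
  shows "locally_dyadic g t"
proof -
  obtain e where e: "e > 0" "dyadic_affine_on {t - e..t} f" "dyadic_affine_on {t..t + e} f"
    "t \<notin> dyadic_rationals \<Longrightarrow> dyadic_affine_on {t - e..t + e} f"
    using assms(1) unfolding locally_dyadic_def by blast
  \<comment> \<open>Halving \<open>d\<close> gives closed intervals inside the open one on which
    \<open>f\<close> and \<open>g\<close> agree.\<close>
  have *: "dyadic_affine_on T g" if "dyadic_affine_on S f" "T \<subseteq> S" "T \<subseteq> {t - d/2..t + d/2}" for S T
  proof (rule dyadic_affine_on_cong[OF dyadic_affine_on_subset[OF that(1,2)]])
    fix s assume "s \<in> T"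
    then have "s \<in> {t - d/2..t + d/2}" using that(3) by blast
    then have "\<bar>s - t\<bar> < d" using \<open>d > 0\<close> unfolding abs_less_iff by (simp add: field_simps)
    then show "f s = g s" by (rule assms(3))
  qed
  show ?thesis
    unfolding locally_dyadic_def
  proof (intro exI[of _ "min e (d/2)"] conjI impI)
    show "min e (d/2) > 0" using e assms(2) by simp
    show "dyadic_affine_on {t - min e (d/2)..t} g" using assms(2) by (intro *[OF e(2)]) auto
    show "dyadic_affine_on {t..t + min e (d/2)} g" using assms(2) by (intro *[OF e(3)]) auto
    show "dyadic_affine_on {t - min e (d/2)..t + min e (d/2)} g" if "t \<notin> dyadic_rationals"
      by (intro *[OF e(4)[OF that]]) auto
  qed
qed

lemma locally_dyadic_translation [simp]:
  assumes "c \<in> dyadic_rationals"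
  shows "locally_dyadic (\<lambda>s. s + c) t"
  using assms by (intro locally_dyadicI_interior[of "t - 1" "t + 1"] dyadic_affine_on_translation) auto

lemma locally_dyadic_dyadic_iff:
  assumes "locally_dyadic h t"
  shows "h t \<in> dyadic_rationals \<longleftrightarrow> t \<in> dyadic_rationals"
proof -
  obtain e where "e > 0" "dyadic_affine_on {t - e..t} h"
    using assms unfolding locally_dyadic_def by blast
  then show ?thesis by (intro dyadic_affine_on_dyadic_iff) auto
qed

lemma locally_dyadic_isCont:
  assumes "locally_dyadic h t"
  shows "isCont h t"
proof -
  obtain e where e: "e > 0" "dyadic_affine_on {t - e..t} h" "dyadic_affine_on {t..t + e} h"
    using assms unfolding locally_dyadic_def by blast
  have *: "continuous_on S h" if "dyadic_affine_on S h" for S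
  proof -
    obtain k c where "\<And>t. t \<in> S \<Longrightarrow> h t = 2 powi (k::int) * t + c"
      using \<open>dyadic_affine_on S h\<close> unfolding dyadic_affine_on_def by blast
    then have "continuous_on S h \<longleftrightarrow> continuous_on S (\<lambda>t. 2 powi k * t + c)"
      by (intro continuous_on_cong) auto
    then show ?thesis by (simp add: continuous_intros)
  qed
  have "continuous_on ({t - e..t} \<union> {t..t + e}) h"
    by (intro continuous_on_closed_Un * e) auto
  moreover have "t \<in> interior ({t - e..t} \<union> {t..t + e})"
    using e(1) by (simp add: ivl_disj_un_two_touch)
  ultimately show ?thesis by (rule continuous_on_interior)
qed

text \<open>Monotonicity sends each side of \<open>t\<close> to the same side of \<open>f t\<close>,
  so one-sided pieces compose, after shrinking by continuity. At a non-dyadic \<open>t\<close> the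
  value \<open>f t\<close> is non-dyadic too, so both maps have a two-sided piece.\<close>

lemma locally_dyadic_comp:
  assumes f: "locally_dyadic f t" and g: "locally_dyadic g (f t)" and mono: "mono f"
  shows "locally_dyadic (g \<circ> f) t"
proof -
  obtain e where e: "e > 0" "dyadic_affine_on {t - e..t} f" "dyadic_affine_on {t..t + e} f"
    "t \<notin> dyadic_rationals \<Longrightarrow> dyadic_affine_on {t - e..t + e} f"
    using f unfolding locally_dyadic_def by blast
  obtain d where d: "d > 0" "dyadic_affine_on {f t - d..f t} g" "dyadic_affine_on {f t..f t + d} g"
    "f t \<notin> dyadic_rationals \<Longrightarrow> dyadic_affine_on {f t - d..f t + d} g"
    using g unfolding locally_dyadic_def by blast
  obtain r where r: "r > 0" "\<And>s. \<bar>s - t\<bar> < r \<Longrightarrow> \<bar>f s - f t\<bar> < d"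
    using locally_dyadic_isCont[OF f] \<open>d > 0\<close> unfolding continuous_at_eps_delta dist_real_def by blast
  define m where "m = min e (r/2)"
  have m: "m > 0" "m \<le> e" "m < r" using e(1) r(1) by (auto simp: m_def)
  have near: "f t - d \<le> f s \<and> f s \<le> f t + d" if "t - m \<le> s" "s \<le> t + m" for s
  proof -
    have "\<bar>s - t\<bar> < r" using that m unfolding abs_less_iff by linarith
    from r(2)[OF this] show ?thesis unfolding abs_less_iff by linarith
  qed
  have 1: "f ` {t - m..t} \<subseteq> {f t - d..f t}" and 2: "f ` {t..t + m} \<subseteq> {f t..f t + d}"
    and 3: "f ` {t - m..t + m} \<subseteq> {f t - d..f t + d}"
    using near m monoD[OF mono] by auto
  show ?thesis
    unfolding locally_dyadic_def
  proof (intro exI[of _ m] conjI impI)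
    show "dyadic_affine_on {t - m..t} (g \<circ> f)"
      using m by (intro dyadic_affine_on_comp[OF dyadic_affine_on_subset[OF e(2)] d(2) 1]) auto
    show "dyadic_affine_on {t..t + m} (g \<circ> f)"
      using m by (intro dyadic_affine_on_comp[OF dyadic_affine_on_subset[OF e(3)] d(3) 2]) auto
    show "dyadic_affine_on {t - m..t + m} (g \<circ> f)" if "t \<notin> dyadic_rationals"
      using m that locally_dyadic_dyadic_iff[OF f]
      by (intro dyadic_affine_on_comp[OF dyadic_affine_on_subset[OF e(4)] d(4) 3]) auto
  qed (use m in simp)
qed

text \<open>Only the inner translation goes through \<open>locally_dyadic_comp\<close>; the outer
  one is composed piece by piece, because \<open>f\<close> is not assumed monotone.\<close>

lemma locally_dyadic_conj_translation:
  assumes f: "locally_dyadic f (t - c)" and c: "c \<in> dyadic_rationals" and d: "d \<in> dyadic_rationals"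
  shows "locally_dyadic (\<lambda>s. f (s - c) + d) t"
proof -
  have "locally_dyadic (\<lambda>s. s + - c) t"
    using c by (intro locally_dyadic_translation dyadic_rationals_minus)
  then have "locally_dyadic (f \<circ> (\<lambda>s. s + - c)) t"
    by (rule locally_dyadic_comp) (use f in \<open>auto simp: mono_def\<close>)
  then obtain e where e: "e > 0" "dyadic_affine_on {t - e..t} (f \<circ> (\<lambda>s. s + - c))"
    "dyadic_affine_on {t..t + e} (f \<circ> (\<lambda>s. s + - c))"
    "t \<notin> dyadic_rationals \<Longrightarrow> dyadic_affine_on {t - e..t + e} (f \<circ> (\<lambda>s. s + - c))"
    unfolding locally_dyadic_def by blast
  have "dyadic_affine_on S (\<lambda>s. f (s - c) + d)" if S: "dyadic_affine_on S (f \<circ> (\<lambda>s. s + - c))" for S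
    using dyadic_affine_on_comp[OF S dyadic_affine_on_translation[OF d refl] subset_UNIV]
    by (simp add: o_def)
  then show ?thesis using e unfolding locally_dyadic_def by blast
qed

text \<open>A monotone surjection of the line has no jumps, hence is continuous. The inverse
  satisfies the same assumptions, so the last claim applies to it as well.\<close>

lemma strict_mono_inv_real:
  fixes f :: "real \<Rightarrow> real"
  assumes "strict_mono f" "surj f"
  shows "strict_mono (inv f)" "surj (inv f)" "inv f (f t) = t" "f (inv f t) = t"
    "continuous_on UNIV f"
proof -
  have inj: "inj f" using assms strict_mono_imp_inj_on by blast
  show inv: "inv f (f t) = t" "f (inv f t) = t" for t
    using inj assms(2) by (simp_all add: surj_f_inv_f)
  show "strict_mono (inv f)"
    using assms(1) inv(2) strict_mono_less[OF assms(1)] unfolding strict_mono_def by metis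
  show "surj (inv f)" using inj by (rule inj_imp_surj_inv)
  show "continuous_on UNIV f"
    using assms by (intro continuous_onI_mono) (auto simp: strict_mono_less_eq)
qed

lemma locally_dyadic_inverse:
  assumes f: "locally_dyadic f t" and "strict_mono f" "surj f"
  shows "locally_dyadic (inv f) (f t)"
proof -
  note inv = strict_mono_inv_real[OF assms(2,3)]
  obtain e where e: "e > 0" "dyadic_affine_on {t - e..t} f" "dyadic_affine_on {t..t + e} f"
    "t \<notin> dyadic_rationals \<Longrightarrow> dyadic_affine_on {t - e..t + e} f"
    using f unfolding locally_dyadic_def by blast
  \<comment> \<open>Chosen so that the interval of radius \<open>d\<close> around \<open>f t\<close>
    lies in the image of the interval of radius \<open>e\<close> around \<open>t\<close>.\<close>
  define d where "d = min (f t - f (t - e)) (f (t + e) - f t)"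
  have d: "d > 0" "f (t - e) \<le> f t - d" "f t + d \<le> f (t + e)"
    using e(1) strict_monoD[OF assms(2)] by (auto simp: d_def)
  have sub: "{f p..f q} \<subseteq> f ` {p..q}" for p q
  proof
    fix u assume "u \<in> {f p..f q}"
    then have "inv f u \<in> {p..q}" "u = f (inv f u)"
      using inv(4) strict_mono_less_eq[OF assms(2)] by (metis atLeastAtMost_iff) (simp add: inv)
    then show "u \<in> f ` {p..q}" by blast
  qed
  have aff: "dyadic_affine_on {f p..f q} (inv f)" if "dyadic_affine_on {p..q} f" for p q
    using dyadic_affine_on_subset[OF dyadic_affine_on_inverse[OF that] sub] inv(3) by blast
  show ?thesis
    unfolding locally_dyadic_def
  proof (intro exI[of _ d] conjI impI)
    show "dyadic_affine_on {f t - d..f t} (inv f)"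
      using d by (intro dyadic_affine_on_subset[OF aff[OF e(2)]]) auto
    show "dyadic_affine_on {f t..f t + d} (inv f)"
      using d by (intro dyadic_affine_on_subset[OF aff[OF e(3)]]) auto
    show "dyadic_affine_on {f t - d..f t + d} (inv f)" if "f t \<notin> dyadic_rationals"
      using d that locally_dyadic_dyadic_iff[OF f]
      by (intro dyadic_affine_on_subset[OF aff[OF e(4)]]) auto
  qed (use d in simp)
qed

text \<open>Reflecting source and target keeps the slope and negates the constant. This turns a map
  to the left of a point into one to its right.\<close>

lemma locally_dyadic_reflect:
  assumes "locally_dyadic f (- t)"
  shows "locally_dyadic (\<lambda>s. - f (- s)) t"
proof -
  obtain e where e: "e > 0" "dyadic_affine_on {- t - e..- t} f" "dyadic_affine_on {- t..- t + e} f"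
    "- t \<notin> dyadic_rationals \<Longrightarrow> dyadic_affine_on {- t - e..- t + e} f"
    using assms unfolding locally_dyadic_def by blast
  have *: "dyadic_affine_on {p..q} (\<lambda>s. - f (- s))" if f: "dyadic_affine_on {-q..-p} f" for p q
  proof -
    obtain k c where "c \<in> dyadic_rationals" "\<And>t. t \<in> {-q..-p} \<Longrightarrow> f t = 2 powi (k::int) * t + c"
      using f unfolding dyadic_affine_on_def by blast
    then show ?thesis
      by (intro dyadic_affine_onI[of "-c" _ _ k]) (auto intro: dyadic_rationals_minus)
  qed
  show ?thesis
    unfolding locally_dyadic_def
  proof (intro exI[of _ e] conjI impI)
    have eq: "- t - e = - (t + e)" "- t + e = - (t - e)" by simp_all
    show "dyadic_affine_on {t - e..t + e} (\<lambda>s. - f (- s))" if "t \<notin> dyadic_rationals"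
    proof -
      have "- t \<notin> dyadic_rationals" using that dyadic_rationals_minus by fastforce
      then show ?thesis using e(4) unfolding eq by (intro *)
    qed
    show "dyadic_affine_on {t - e..t} (\<lambda>s. - f (- s))"
      using e(3) unfolding eq by (rule *)
    show "dyadic_affine_on {t..t + e} (\<lambda>s. - f (- s))"
      using e(2) unfolding eq by (rule *)
  qed (use e in simp)
qed


section \<open>From local to global\<close>

text \<open>The invariant speaks of all sufficiently fine grids, since two grids have a common refinement.\<close>

lemma locally_dyadic_grid:
  assumes "a \<le> b" and ld: "\<And>t. a \<le> t \<Longrightarrow> t \<le> b \<Longrightarrow> locally_dyadic h t"
  shows "\<exists>N. \<forall>n\<ge>N. \<forall>m::int. {of_int m / 2 ^ n..of_int (m + 1) / 2 ^ n} \<inter> {a..b} \<noteq> {} \<longrightarrow>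
           dyadic_affine_on {of_int m / 2 ^ n..of_int (m + 1) / 2 ^ n} h"
    (is "?P a b")
  using assms(1)
proof (induction rule: Bolzano)
  case (trans a b c)
  obtain N where N: "\<And>n m. n \<ge> N \<Longrightarrow> {of_int m / 2 ^ n..of_int (m + 1) / 2 ^ n} \<inter> {a..b} \<noteq> {} \<Longrightarrow>
           dyadic_affine_on {of_int m / 2 ^ n..of_int (m + 1) / 2 ^ n} h"
    using trans(1) by blast
  obtain N' where N': "\<And>n m. n \<ge> N' \<Longrightarrow> {of_int m / 2 ^ n..of_int (m + 1) / 2 ^ n} \<inter> {b..c} \<noteq> {} \<Longrightarrow>
           dyadic_affine_on {of_int m / 2 ^ n..of_int (m + 1) / 2 ^ n} h"
    using trans(2) by blast
  have ac: "{a..c} \<subseteq> {a..b} \<union> {b..c}" by auto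
  show ?case
  proof (intro exI[of _ "max N N'"] allI impI)
    fix n m assume n: "max N N' \<le> n"
      and "{of_int m / 2 ^ n..of_int (m + 1) / 2 ^ n} \<inter> {a..c} \<noteq> {}"
    then have "{of_int m / 2 ^ n..of_int (m + 1) / 2 ^ n} \<inter> {a..b} \<noteq> {} \<or>
        {of_int m / 2 ^ n..of_int (m + 1) / 2 ^ n} \<inter> {b..c} \<noteq> {}"
      using ac by blast
    then show "dyadic_affine_on {of_int m / 2 ^ n..of_int (m + 1) / 2 ^ n} h"
      using N N' n by auto
  qed
next
  case (local x)
  obtain e where e: "e > 0" "dyadic_affine_on {x - e..x} h" "dyadic_affine_on {x..x + e} h"
    "x \<notin> dyadic_rationals \<Longrightarrow> dyadic_affine_on {x - e..x + e} h"
    using ld[OF local] unfolding locally_dyadic_def by blast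
  \<comment> \<open>Cells shorter than \<open>e / 2\<close> that meet an interval of length below
    \<open>e / 2\<close> around \<open>x\<close> lie within distance \<open>e\<close> of
    \<open>x\<close>.\<close>
  obtain N0 where N0: "1 / 2 ^ N0 < e / 2"
    using real_arch_pow_inv[of "e / 2" "1 / 2"] e(1) by (auto simp: power_one_over)
  \<comment> \<open>A dyadic \<open>x\<close> is a grid point at every level from \<open>K\<close>
    on, so each cell lies on one side of \<open>x\<close>, and the one-sided pieces suffice. A
    non-dyadic \<open>x\<close> has a two-sided piece.\<close>
  obtain K where K: "\<And>n. x \<in> dyadic_rationals \<Longrightarrow> n \<ge> K \<Longrightarrow> \<exists>j::int. x = of_int j / 2 ^ n"
  proof (cases "x \<in> dyadic_rationals")
    case True
    then obtain j k where x: "x = of_int j / 2 ^ k" unfolding dyadic_rationals_def by blast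
    have "x = of_int (j * 2 ^ (n - k)) / 2 ^ n" if "n \<ge> k" for n
    proof -
      have "(2::real) ^ n = 2 ^ (n - k) * 2 ^ k" using that by (simp flip: power_add)
      then show ?thesis by (simp add: x)
    qed
    then show thesis using that by blast
  qed (use that in blast)
  have aff: "dyadic_affine_on {of_int m / 2 ^ n..of_int (m + 1) / 2 ^ n} h"
    if n: "n \<ge> max N0 K" and meet: "{of_int m / 2 ^ n..of_int (m + 1) / 2 ^ n} \<inter> {a..b} \<noteq> {}"
      and ab: "a \<le> x" "x \<le> b" "b - a < e / 2" for a b n and m :: int
  proof -
    have "1 / 2 ^ n \<le> (1 / 2 ^ N0 :: real)" using n by (simp add: frac_le)
    then have len: "1 / 2 ^ n < e / 2" using N0 by linarith
    have step: "of_int (m + 1) / 2 ^ n = of_int m / 2 ^ n + (1 / 2 ^ n :: real)"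
      by (simp add: add_divide_distrib)
    obtain u where "u \<in> {of_int m / 2 ^ n..of_int (m + 1) / 2 ^ n} \<inter> {a..b}"
      using meet by blast
    then have u: "of_int m / 2 ^ n \<le> u" "u \<le> of_int (m + 1) / 2 ^ n" "a \<le> u" "u \<le> b"
      by auto
    have in_e: "{of_int m / 2 ^ n..of_int (m + 1) / 2 ^ n} \<subseteq> {x - e..x + e}"
      using u ab len step by auto
    show ?thesis
    proof (cases "x \<in> dyadic_rationals")
      case True
      then obtain j :: int where j: "x = of_int j / 2 ^ n" using K n by auto
      consider "j \<le> m" | "m + 1 \<le> j" by linarith
      then show ?thesis
      proof cases
        case 1
        then have "x \<le> of_int m / 2 ^ n" by (simp add: j divide_right_mono)
        then show ?thesis using in_e by (intro dyadic_affine_on_subset[OF e(3)]) auto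
      next
        case 2
        then have "of_int (m + 1) \<le> (of_int j :: real)" by linarith
        then have "of_int (m + 1) / 2 ^ n \<le> x" unfolding j by (intro divide_right_mono) auto
        then show ?thesis using in_e by (intro dyadic_affine_on_subset[OF e(2)]) auto
      qed
    next
      case False
      then show ?thesis using dyadic_affine_on_subset[OF e(4)] in_e by blast
    qed
  qed
  show ?case
  proof (intro exI[of _ "e / 2"] conjI allI impI)
    show "e / 2 > 0" using e(1) by simp
    fix a b assume "a \<le> x \<and> x \<le> b \<and> b - a < e / 2"
    then show "?P a b" using aff by blast
  qed
qed

lemma dyadic_pl_if_locally_dyadic:
  assumes "\<And>t. locally_dyadic h t"
  shows "dyadic_pl 0 1 h"
proof -
  obtain n where n: "\<And>m::int. {of_int m / 2 ^ n..of_int (m + 1) / 2 ^ n} \<inter> {0..1::real} \<noteq> {} \<Longrightarrow>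
      dyadic_affine_on {of_int m / 2 ^ n..of_int (m + 1) / 2 ^ n} h"
    using locally_dyadic_grid[of 0 1 h] assms by fastforce
  show ?thesis
    unfolding dyadic_pl_def
  proof (rule exI[of _ "2 ^ n"], rule exI[of _ "\<lambda>i. of_nat i / 2 ^ n"], intro conjI allI impI)
    show "real i / 2 ^ n \<in> dyadic_rationals" for i
      using dyadic_rationals_divide_power[of "int i" n] by simp
    fix i :: nat assume i: "i < 2 ^ n"
    show "real i / 2 ^ n < real (Suc i) / 2 ^ n" by (simp add: divide_strict_right_mono)
    have "real i \<le> 2 ^ n" using i by (metis less_imp_le numeral_power_le_of_nat_cancel_iff of_nat_le_numeral_power_cancel_iff)
    then have "real i / 2 ^ n \<in> {of_int (int i) / 2 ^ n..of_int (int i + 1) / 2 ^ n} \<inter> {0..1}"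
      by (auto simp: divide_right_mono)
    then have "dyadic_affine_on {of_int (int i) / 2 ^ n..of_int (int i + 1) / 2 ^ n} h"
      using n by blast
    then show "\<exists>(k :: int) c. \<forall>t\<in>{real i / 2 ^ n..real (Suc i) / 2 ^ n}. h t = 2 powi k * t + c"
      unfolding dyadic_affine_on_def by (auto simp: add.commute)
  qed auto
qed

section \<open>From a dyadic subdivision back to the local condition\<close>

lemma sequence_interval:
  fixes p :: "nat \<Rightarrow> real"
  shows "p 0 \<le> t \<Longrightarrow> t < p n \<Longrightarrow> \<exists>i<n. p i \<le> t \<and> t < p (Suc i)"
    and "p 0 < t \<Longrightarrow> t \<le> p n \<Longrightarrow> \<exists>i<n. p i < t \<and> t \<le> p (Suc i)"
proof (induction n)
  case (Suc n)
  { case 1 then show ?case using Suc.IH(1) by (cases "p n \<le> t") (auto simp: less_Suc_eq) }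
  { case 2 then show ?case using Suc.IH(2) by (cases "p n < t") (auto simp: less_Suc_eq) }
qed auto

text \<open>In \<open>dyadic_pl\<close> the constants are arbitrary reals. They are dyadic once the
  value at \<open>a\<close> is: along the subdivision, a dyadic value at \<open>p i\<close> makes
  the constant of that piece dyadic, and with it the value at \<open>p (Suc i)\<close>.\<close>

lemma dyadic_pl_pieces:
  assumes "dyadic_pl a b h" "h a \<in> dyadic_rationals"
  obtains n p where "p 0 = a" "p n = b" "\<And>i. i \<le> n \<Longrightarrow> p i \<in> dyadic_rationals"
    "\<And>i. i < n \<Longrightarrow> p i < p (Suc i)" "\<And>i. i < n \<Longrightarrow> dyadic_affine_on {p i..p (Suc i)} h"
proof -
  obtain n :: nat and p where p: "p 0 = a" "p n = b" "\<And>i. i \<le> n \<Longrightarrow> p i \<in> dyadic_rationals"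
    "\<And>i. i < n \<Longrightarrow> p i < p (Suc i)"
    "\<And>i. i < n \<Longrightarrow> \<exists>(k :: int) c. \<forall>t\<in>{p i..p (Suc i)}. h t = 2 powi k * t + c"
    using assms(1) unfolding dyadic_pl_def by blast
  have piece: "dyadic_affine_on {p i..p (Suc i)} h" if "i < n" "h (p i) \<in> dyadic_rationals" for i
  proof -
    obtain k c where kc: "\<And>t. t \<in> {p i..p (Suc i)} \<Longrightarrow> h t = 2 powi (k::int) * t + c"
      using p(5)[OF \<open>i < n\<close>] by blast
    then have "c = h (p i) - 2 powi k * p i" using p(4)[OF \<open>i < n\<close>] by simp
    moreover have "h (p i) - 2 powi k * p i \<in> dyadic_rationals"
      using that p(3)[of i] by (intro dyadic_rationals_intros dyadic_rationals_powi) auto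
    ultimately show ?thesis using kc dyadic_affine_onI by metis
  qed
  have "i \<le> n \<Longrightarrow> h (p i) \<in> dyadic_rationals" for i
  proof (induction i)
    case 0
    then show ?case using assms(2) p(1) by simp
  next
    case (Suc i)
    then have "dyadic_affine_on {p i..p (Suc i)} h" using piece by simp
    moreover have "p (Suc i) \<in> {p i..p (Suc i)}" using p(4)[of i] Suc.prems by simp
    ultimately show ?case using dyadic_affine_on_dyadic_iff p(3) Suc.prems by blast
  qed
  then show thesis using that[OF p(1,2,3,4)] piece by simp
qed

lemma dyadic_pl_right:
  assumes "dyadic_pl a b h" "h a \<in> dyadic_rationals" "a \<le> t" "t < b"
  obtains q where "t < q" "dyadic_affine_on {t..q} h"
proof -
  obtain n p where p: "p 0 = a" "p n = b" "\<And>i. i < n \<Longrightarrow> dyadic_affine_on {p i..p (Suc i)} h"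
    using dyadic_pl_pieces[OF assms(1,2)] by metis
  obtain i where "i < n" "p i \<le> t" "t < p (Suc i)"
    using sequence_interval(1)[of p t n] p assms by auto
  then show thesis using that[of "p (Suc i)"] dyadic_affine_on_subset[OF p(3)] by auto
qed

lemma dyadic_pl_left:
  assumes "dyadic_pl a b h" "h a \<in> dyadic_rationals" "a < t" "t \<le> b"
  obtains q where "q < t" "dyadic_affine_on {q..t} h"
proof -
  obtain n p where p: "p 0 = a" "p n = b" "\<And>i. i < n \<Longrightarrow> dyadic_affine_on {p i..p (Suc i)} h"
    using dyadic_pl_pieces[OF assms(1,2)] by metis
  obtain i where "i < n" "p i < t" "t \<le> p (Suc i)"
    using sequence_interval(2)[of p t n] p assms by auto
  then show thesis using that[of "p i"] dyadic_affine_on_subset[OF p(3)] by auto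
qed

lemma dyadic_pl_interior:
  assumes pl: "dyadic_pl a b h" "h a \<in> dyadic_rationals" and t: "a < t" "t < b"
  shows "locally_dyadic h t"
proof (cases "t \<in> dyadic_rationals")
  case True
  obtain q where "q < t" "dyadic_affine_on {q..t} h"
    using dyadic_pl_left[OF pl] t by (metis less_imp_le)
  moreover obtain r where "t < r" "dyadic_affine_on {t..r} h"
    using dyadic_pl_right[OF pl] t by (metis less_imp_le)
  ultimately show ?thesis using True locally_dyadicI_dyadic by blast
next
  case False
  obtain n p where p: "p 0 = a" "p n = b" "\<And>i. i \<le> n \<Longrightarrow> p i \<in> dyadic_rationals"
    "\<And>i. i < n \<Longrightarrow> dyadic_affine_on {p i..p (Suc i)} h"
    using dyadic_pl_pieces[OF pl] by metis
  obtain i where i: "i < n" "p i \<le> t" "t < p (Suc i)"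
    using sequence_interval(1)[of p t n] p t by auto
  \<comment> \<open>Subdivision points are dyadic, so a non-dyadic \<open>t\<close> lies strictly
    inside its piece.\<close>
  moreover have "p i \<noteq> t" using False p(3)[of i] i by auto
  ultimately show ?thesis using locally_dyadicI_interior[OF p(4)[OF i(1)]] by simp
qed


section \<open>Moving a point by a locally dyadic homeomorphism of its complement\<close>

text \<open>\<open>dyadic_expansion x a\<close>: the \<open>a i\<close> are partial sums of an infinite binary expansion of \<open>x\<close>.\<close>

definition dyadic_expansion :: "real \<Rightarrow> (nat \<Rightarrow> real) \<Rightarrow> bool" where
  "dyadic_expansion x a \<longleftrightarrow> a 0 = 0 \<and>
     (\<forall>i. a i \<in> dyadic_rationals \<and> a i < x \<and> (\<exists>k::int. a (Suc i) - a i = 2 powi k)) \<and>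
     (\<forall>t<x. \<exists>i. t < a i)"

section \<open>Infinite binary expansions and the map they define\<close>

lemma powi_between:
  assumes "r > (0::real)"
  obtains k :: int where "2 powi k < r" "r \<le> 2 * 2 powi k"
proof
  \<comment> \<open>Ceiling minus one instead of the floor: the lower bound stays strict when
    \<open>r\<close> is itself a power of 2, so an expansion never reaches its limit.\<close>
  define k where "k = \<lceil>log 2 r\<rceil> - 1"
  have powi: "2 powi j = (2::real) powr (of_int j)" for j :: int
    by (simp add: powr_real_of_int')
  have "of_int k < log 2 r" "log 2 r \<le> of_int (k + 1)"
    unfolding k_def by linarith+
  then have "2 powr (of_int k) < r" "r \<le> 2 powr (of_int (k + 1))"
    using assms by (simp_all add: less_log_iff log_le_iff)
  then show "2 powi k < r" "r \<le> 2 * 2 powi k"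
    unfolding powi by (simp_all add: powr_add)
qed

text \<open>Greedy choice: add the largest power of 2 that is strictly below the remaining gap. It
  is at least half of the gap, so the gap is at least halved in each step and the sums converge to
  \<open>x\<close>.\<close>

lemma dyadic_expansion_exists:
  assumes "x > 0"
  obtains a where "dyadic_expansion x a"
proof -
  have "\<exists>a. \<forall>n. (a n \<in> dyadic_rationals \<and> a n < x \<and> (n = 0 \<longrightarrow> a n = 0)) \<and>
      ((\<exists>k::int. a (Suc n) - a n = 2 powi k) \<and> x - a (Suc n) \<le> (x - a n) / 2)"
  proof (rule dependent_nat_choice)
    show "\<exists>s. s \<in> dyadic_rationals \<and> s < x \<and> (0 = (0::nat) \<longrightarrow> s = 0)"
      using assms by (intro exI[of _ 0]) auto
    fix s :: real and n :: nat
    assume s: "s \<in> dyadic_rationals \<and> s < x \<and> (n = 0 \<longrightarrow> s = 0)"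
    then obtain k :: int where "2 powi k < x - s" "x - s \<le> 2 * 2 powi k"
      using powi_between[of "x - s"] by auto
    then show "\<exists>s'. (s' \<in> dyadic_rationals \<and> s' < x \<and> (Suc n = 0 \<longrightarrow> s' = 0)) \<and>
        ((\<exists>k::int. s' - s = 2 powi k) \<and> x - s' \<le> (x - s) / 2)"
      using s by (intro exI[of _ "s + 2 powi k"]) (auto intro!: dyadic_rationals_add)
  qed
  then obtain a where a: "\<And>n. a n \<in> dyadic_rationals" "\<And>n. a n < x" "a 0 = 0"
    "\<And>n. \<exists>k::int. a (Suc n) - a n = 2 powi k" "\<And>n. x - a (Suc n) \<le> (x - a n) / 2"
    by blast
  have gap: "x - a n \<le> x * (1 / 2) ^ n" for n
  proof (induction n)
    case (Suc n)
    then show ?case using a(5)[of n] by simp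
  qed (simp add: a)
  have "\<exists>i. t < a i" if "t < x" for t
  proof -
    have "(x - t) / x > 0" using that assms by simp
    then obtain n where "(1 / 2) ^ n < (x - t) / x"
      using real_arch_pow_inv[of "(x - t) / x" "1 / 2"] by auto
    then have "x * (1 / 2) ^ n < x - t" using assms by (simp add: field_simps)
    then show ?thesis using gap[of n] by (intro exI[of _ n]) linarith
  qed
  then show thesis using a that unfolding dyadic_expansion_def by blast
qed

lemma dyadic_expansion_interval:
  assumes "dyadic_expansion x a" "0 \<le> t" "t < x"
  obtains i where "a i \<le> t" "t < a (Suc i)"
proof -
  obtain n where "t < a n" using assms unfolding dyadic_expansion_def by blast
  then show thesis using sequence_interval(1)[of a t n] assms that by (auto simp: dyadic_expansion_def)
qed

text \<open>
  Consecutive partial sums of binary expansions of \<open>x\<close> and \<open>y\<close> cut \<open>[0, x)\<close> and \<open>[0, y)\<close> into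
  intervals whose lengths are powers of 2; matching these intervals affinely gives the map.
\<close>

lemma locally_dyadic_ray_map:
  assumes "x > 0" "y > 0"
  obtains f where "strict_mono_on {..<x} f" "f ` {..<x} = {..<y}" "\<And>t. t \<le> 0 \<Longrightarrow> f t = t"
    "\<And>t. t < x \<Longrightarrow> locally_dyadic f t"
proof -
  obtain a where a': "dyadic_expansion x a" using assms dyadic_expansion_exists by blast
  obtain b where b': "dyadic_expansion y b" using assms dyadic_expansion_exists by blast
  have a: "a 0 = 0" "\<And>i. a i \<in> dyadic_rationals" "\<And>i. a i < x"
    using a' by (auto simp: dyadic_expansion_def)
  have b: "b 0 = 0" "\<And>i. b i \<in> dyadic_rationals" "\<And>i. b i < y"
    using b' by (auto simp: dyadic_expansion_def)
  have a_Suc: "a i < a (Suc i)" for i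
  proof -
    obtain k :: int where "a (Suc i) - a i = 2 powi k" using a' unfolding dyadic_expansion_def by blast
    moreover have "2 powi k > (0::real)" by simp
    ultimately show ?thesis by linarith
  qed
  have b_Suc: "b i < b (Suc i)" for i
  proof -
    obtain k :: int where "b (Suc i) - b i = 2 powi k" using b' unfolding dyadic_expansion_def by blast
    moreover have "2 powi k > (0::real)" by simp
    ultimately show ?thesis by linarith
  qed
  have a_mono: "a i \<le> a j" if "i \<le> j" for i j
    using that by (rule lift_Suc_mono_le[rotated]) (simp add: a_Suc less_imp_le)
  define s where "s i = (b (Suc i) - b i) / (a (Suc i) - a i)" for i
  have s_pos: "s i > 0" for i using a_Suc[of i] b_Suc[of i] by (simp add: s_def)
  have s_powi: "\<exists>k::int. s i = 2 powi k" for i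
  proof -
    obtain k l :: int where "a (Suc i) - a i = 2 powi k" "b (Suc i) - b i = 2 powi l"
      using a' b' unfolding dyadic_expansion_def by metis
    then have "s i = 2 powi (l - k)" by (simp add: s_def power_int_diff)
    then show ?thesis by blast
  qed
  \<comment> \<open>The least index picks the interval that contains \<open>t\<close>, for
    \<open>0 \<le> t\<close> and \<open>t < x\<close>. For \<open>t \<ge> x\<close> no index
    qualifies and the value is arbitrary.\<close>
  define f where "f t = (if t < 0 then t else
      let i = LEAST i. t < a (Suc i) in b i + (t - a i) * s i)" for t
  have f_neg: "f t = t" if "t < 0" for t using that by (simp add: f_def)
  have f_Ico: "f t = b i + (t - a i) * s i" if "a i \<le> t" "t < a (Suc i)" for t i
  proof -
    have "(LEAST i. t < a (Suc i)) = i"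
    proof (rule Least_equality)
      fix j assume "t < a (Suc j)"
      then show "i \<le> j" using that(1) a_mono[of "Suc j" i] by force
    qed (rule that)
    moreover have "\<not> t < 0" using that(1) a_mono[of 0 i] a(1) by simp
    ultimately show ?thesis by (simp add: f_def)
  qed
  have f_a: "f (a i) = b i" for i using f_Ico[of i "a i"] a_Suc[of i] by simp
  have f_Icc: "f t = b i + (t - a i) * s i" if "t \<in> {a i..a (Suc i)}" for t i
  proof (cases "t = a (Suc i)")
    case True
    have "b i + (t - a i) * s i = b (Suc i)"
      using True a_Suc[of i] by (simp add: s_def)
    then show ?thesis using True f_a by simp
  qed (use that f_Ico in auto)
  have f0: "f t = t" if "t \<le> 0" for t
    using that f_neg[of t] f_a[of 0] a(1) b(1) by (cases "t = 0") auto
  have aff: "dyadic_affine_on {a i..a (Suc i)} f" for i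
  proof -
    obtain k :: int where k: "s i = 2 powi k" using s_powi by blast
    show ?thesis
    proof (rule dyadic_affine_onI)
      show "b i - 2 powi k * a i \<in> dyadic_rationals"
        by (intro dyadic_rationals_intros dyadic_rationals_powi a b)
      show "f t = 2 powi k * t + (b i - 2 powi k * a i)" if "t \<in> {a i..a (Suc i)}" for t
        using f_Icc[OF that] k by (simp add: algebra_simps)
    qed
  qed
  have aff_neg: "dyadic_affine_on {q..0} f" for q
    by (rule dyadic_affine_on_translation[where c = 0]) (auto simp: f0)
  have ld: "locally_dyadic f t" if t: "t < x" for t
  proof (cases "t \<ge> 0")
    case True
    then obtain i where i: "a i \<le> t" "t < a (Suc i)"
      using dyadic_expansion_interval[OF a' _ t] by blast
    show ?thesis
    proof (cases "a i = t")
      case False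
      then show ?thesis using i locally_dyadicI_interior[OF aff[of i]] by simp
    next
      case ai: True
      show ?thesis
      \<comment> \<open>At the partial sum \<open>a i\<close> a break is allowed, as it is dyadic.
        The piece to its left is the identity on the negative side if \<open>i = 0\<close>, and the
        preceding interval otherwise.\<close>
      proof (cases i)
        case 0
        then show ?thesis
          using ai i a(1) aff[of 0] aff_neg[of "-1"] locally_dyadicI_dyadic[of "-1" t f "a (Suc 0)"] by auto
      next
        case (Suc j)
        then show ?thesis
          using ai i a(2)[of i] aff[of i] aff[of j] a_Suc[of j]
            locally_dyadicI_dyadic[of "a j" t f "a (Suc i)"] by auto
      qed
    qed
  next
    case False
    then show ?thesis
      using locally_dyadicI_interior[OF aff_neg[of "t - 1"]] by simp
  qed
  \<comment> \<open>Monotonicity is glued piece by piece up to \<open>a n\<close>; since the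
    \<open>a n\<close> exhaust everything below \<open>x\<close>, it then holds on the whole
    ray.\<close>
  have sm: "strict_mono_on {..a n} f" for n
  proof (induction n)
    case 0
    then show ?case using a(1) by (auto simp: strict_mono_on_def f0)
  next
    case (Suc n)
    have piece: "f u < f v" if "a n \<le> u" "u < v" "v \<le> a (Suc n)" for u v
      using that f_Icc[of u n] f_Icc[of v n] s_pos[of n] by simp
    show ?case
    proof (rule strict_mono_onI)
      fix u v assume uv: "u \<in> {..a (Suc n)}" "v \<in> {..a (Suc n)}" "u < v"
      consider "v \<le> a n" | "a n \<le> u" | "u < a n" "a n < v" by linarith
      then show "f u < f v"
      proof cases
        case 1
        then show ?thesis using strict_mono_onD[OF Suc] uv by simp
      next
        case 2
        then show ?thesis using piece uv by simp
      next
        case 3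
        have "f u < f (a n)" using strict_mono_onD[OF Suc] 3 by simp
        also have "\<dots> < f v" using piece 3 uv by simp
        finally show ?thesis .
      qed
    qed
  qed
  have below: "\<exists>n. t < a n" if "t < x" for t
    using a' that unfolding dyadic_expansion_def by blast
  have mono: "strict_mono_on {..<x} f"
  proof (rule strict_mono_onI)
    fix u v assume uv: "u \<in> {..<x}" "v \<in> {..<x}" "u < v"
    then obtain n where "v < a n" using below by auto
    then show "f u < f v" using strict_mono_onD[OF sm[of n]] uv by simp
  qed
  have "f ` {..<x} = {..<y}"
  proof (intro equalityI subsetI)
    fix u assume "u \<in> f ` {..<x}"
    then obtain t where t: "t < x" "u = f t" by auto
    then obtain n where "t < a n" using below by auto
    then have "f t < f (a n)" using strict_mono_onD[OF sm[of n]] by simp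
    then show "u \<in> {..<y}" using t f_a b(3)[of n] by simp
  next
    fix u assume u: "u \<in> {..<y}"
    show "u \<in> f ` {..<x}"
    proof (cases "u \<ge> 0")
      case True
      then obtain i where i: "b i \<le> u" "u < b (Suc i)"
        using dyadic_expansion_interval[OF b'] u by auto
      define t where "t = a i + (u - b i) / s i"
      have "(u - b i) / s i \<le> (b (Suc i) - b i) / s i"
        using i s_pos[of i] by (intro divide_right_mono) auto
      also have "\<dots> = a (Suc i) - a i" using a_Suc[of i] b_Suc[of i] by (simp add: s_def)
      finally have "t \<in> {a i..a (Suc i)}" using i s_pos[of i] by (simp add: t_def)
      moreover from this have "f t = u" using f_Icc[of t i] s_pos[of i] by (simp add: t_def)
      ultimately show ?thesis using a(3)[of "Suc i"] by force
    next
      case False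
      then have "f u = u" "u < x" using f0 assms by auto
      then show ?thesis by force
    qed
  qed
  then show thesis using that mono f0 ld by blast
qed

text \<open>Two ray maps are joined at \<open>x\<close>: one for \<open>x\<close> and
  \<open>y\<close> on the left, and one for \<open>1 - x\<close> and \<open>1 - y\<close>, reflected
  at 1/2, on the right. Ray maps are the identity up to 0, so the result is the identity off the
  unit interval.\<close>

lemma locally_dyadic_off_point:
  assumes x: "0 < x" "x < 1" and y: "0 < y" "y < 1"
  obtains f where "strict_mono f" "surj f" "f x = y" "\<And>t. t \<notin> {0<..<1} \<Longrightarrow> f t = t"
    "\<And>t. t \<noteq> x \<Longrightarrow> locally_dyadic f t"
proof -
  obtain g where g: "strict_mono_on {..<x} g" "g ` {..<x} = {..<y}" "\<And>t. t \<le> 0 \<Longrightarrow> g t = t"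
    "\<And>t. t < x \<Longrightarrow> locally_dyadic g t"
    using locally_dyadic_ray_map x y by metis
  obtain h where h: "strict_mono_on {..<1 - x} h" "h ` {..<1 - x} = {..<1 - y}"
    "\<And>t. t \<le> 0 \<Longrightarrow> h t = t" "\<And>t. t < 1 - x \<Longrightarrow> locally_dyadic h t"
    using locally_dyadic_ray_map[of "1 - x" "1 - y"] x y by auto
  define f where "f t = (if t < x then g t else if t = x then y else 1 - h (1 - t))" for t
  have g_lt: "g t < y" if "t < x" for t using g(2) that by auto
  have h_lt: "h (1 - t) < 1 - y" if "t > x" for t
  proof -
    have "h (1 - t) \<in> h ` {..<1 - x}" using that by auto
    then show ?thesis using h(2) by simp
  qed
  have "strict_mono f"
  proof (rule strict_monoI)
    fix s t :: real assume st: "s < t"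
    consider "t < x" | "s < x" "x \<le> t" | "s = x" | "s > x" by linarith
    then show "f s < f t"
    proof cases
      case 1
      then show ?thesis using st strict_mono_onD[OF g(1)] by (simp add: f_def)
    next
      case 2
      then show ?thesis using g_lt[of s] h_lt[of t] by (auto simp: f_def)
    next
      case 3
      then show ?thesis using st h_lt[of t] by (auto simp: f_def)
    next
      case 4
      then have "h (1 - t) < h (1 - s)" using st by (intro strict_mono_onD[OF h(1)]) auto
      then show ?thesis using 4 st by (simp add: f_def)
    qed
  qed
  moreover have "\<exists>t. f t = u" for u
  proof -
    consider "u < y" | "u = y" | "1 - u < 1 - y" by linarith
    then show ?thesis
    proof cases
      case 1
      then have "u \<in> g ` {..<x}" using g(2) by simp
      then obtain t where "t < x" "u = g t" by auto
      then show ?thesis by (auto simp: f_def intro!: exI[of _ t])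
    next
      case 2
      then show ?thesis by (auto simp: f_def intro!: exI[of _ x])
    next
      case 3
      then have "1 - u \<in> h ` {..<1 - x}" using h(2) by simp
      then obtain t where "t < 1 - x" "1 - u = h t" by auto
      then show ?thesis by (auto simp: f_def intro!: exI[of _ "1 - t"])
    qed
  qed
  then have "surj f" unfolding surj_def by metis
  moreover have "f t = t" if "t \<notin> {0<..<1}" for t
    using that x g(3)[of t] h(3)[of "1 - t"] by (auto simp: f_def)
  moreover have "locally_dyadic f t" if "t \<noteq> x" for t
  proof (cases "t < x")
    case True
    have "\<And>s. \<bar>s - t\<bar> < x - t \<Longrightarrow> g s = f s" by (simp add: f_def abs_less_iff)
    then show ?thesis using locally_dyadic_cong[OF g(4)[OF True], of "x - t" f] True by auto
  next
    case False
    then have t: "t > x" using that by simp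
    \<comment> \<open>The reflection \<open>s \<mapsto> 1 - h (1 - s)\<close> is split into the
      reflection at 0 and translations by an integer.\<close>
    have "locally_dyadic (\<lambda>s. h (s - - 1) + - 1) (- t)"
      using t h(4)[of "1 - t"] dyadic_rationals_of_int[of "-1"]
      by (intro locally_dyadic_conj_translation) auto
    from locally_dyadic_reflect[OF this] have 1: "locally_dyadic (\<lambda>s. 1 - h (1 - s)) t"
      by simp
    have "1 - h (1 - s) = f s" if "\<bar>s - t\<bar> < t - x" for s
      using that t by (simp add: f_def abs_less_iff)
    then show ?thesis using t locally_dyadic_cong[OF 1, of "t - x" f] by auto
  qed
  moreover have "f x = y" by (simp add: f_def)
  ultimately show thesis using that by blast
qed

section \<open>Conjugation and homeomorphisms of the line\<close>

lemma locally_dyadic_conjugate: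
  assumes f: "strict_mono f" "surj f" and h: "strict_mono h"
    and "locally_dyadic f (inv f t)" "locally_dyadic h (inv f t)" "locally_dyadic f (h (inv f t))"
  shows "locally_dyadic (f \<circ> h \<circ> inv f) t"
proof -
  note inv = strict_mono_inv_real[OF f]
  have "locally_dyadic (inv f) t"
    using locally_dyadic_inverse[OF assms(4) f] inv by simp
  moreover have "locally_dyadic (f \<circ> h) (inv f t)"
    using locally_dyadic_comp[OF assms(5,6) strict_mono_mono[OF h]] .
  ultimately show ?thesis
    using locally_dyadic_comp strict_mono_mono[OF inv(1)] by blast
qed

lemma homeomorphic_maps_strict_mono:
  fixes f :: "real \<Rightarrow> real"
  assumes "strict_mono f" "surj f" "\<And>t. f t \<in> S \<longleftrightarrow> t \<in> S"
  shows "homeomorphic_maps (top_of_set S) (top_of_set S) f (inv f)"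
proof -
  note inv = strict_mono_inv_real[OF assms(1,2)]
  have "continuous_on UNIV (inv f)" using strict_mono_inv_real(5) inv(1,2) by blast
  then have "homeomorphic_maps euclidean euclidean f (inv f)"
    using inv by (auto simp: homeomorphic_maps_def)
  then show ?thesis
  proof (rule homeomorphic_maps_subtopologies_alt)
    show "inv f ` (topspace euclidean \<inter> S) \<subseteq> S"
    proof
      fix t assume "t \<in> inv f ` (topspace euclidean \<inter> S)"
      then show "t \<in> S" using assms(3)[of t] inv by auto
    qed
  qed (use assms in auto)
qed


section \<open>Thompson's group \<open>F\<close>\<close>

lemma fixes_outside_interval_mem_iff:
  fixes h :: "real \<Rightarrow> real"
  assumes "strict_mono h" "\<And>t. t \<notin> {0<..<1} \<Longrightarrow> h t = t"
  shows "h t \<in> {0<..<1} \<longleftrightarrow> t \<in> {0<..<1}" "h t \<in> {0..1} \<longleftrightarrow> t \<in> {0..1}"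
proof -
  have "h 0 = 0" "h 1 = 1" using assms(2) by auto
  then show "h t \<in> {0<..<1} \<longleftrightarrow> t \<in> {0<..<1}" "h t \<in> {0..1} \<longleftrightarrow> t \<in> {0..1}"
    using strict_mono_less[OF assms(1), of 0 t] strict_mono_less[OF assms(1), of t 1]
      strict_mono_less_eq[OF assms(1), of 0 t] strict_mono_less_eq[OF assms(1), of t 1] by auto
qed

text \<open>An element of F fixes both endpoints, so it extends by the identity to an increasing
  bijection of the line; possible breaks at 0 and 1 are harmless because these points are
  dyadic.\<close>

lemma thompson_F_eq:
  "thompson_F = {restrict h {0<..<1} | h. strict_mono h \<and> surj h \<and>
     (\<forall>t. t \<notin> {0<..<1} \<longrightarrow> h t = t) \<and> (\<forall>t. locally_dyadic h t)}"
proof (intro equalityI subsetI)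
  fix g assume "g \<in> thompson_F"
  then obtain h where h: "g = restrict h {0<..<1}"
    "homeomorphic_map (top_of_set {0..1}) (top_of_set {0..1}) h"
    "strict_mono_on {0..1} h" "dyadic_pl 0 1 h"
    unfolding thompson_F_def by blast
  have im: "h ` {0..1} = {0..1}" using homeomorphic_imp_surjective_map[OF h(2)] by simp
  then have bounds: "0 \<le> h t" "h t \<le> 1" if "0 \<le> t" "t \<le> 1" for t using that by auto
  have h0: "h 0 = 0"
  proof -
    obtain s where "s \<in> {0..1}" "h s = 0" using im by (metis atLeastAtMost_iff imageE order_refl zero_le_one)
    then show ?thesis using strict_mono_onD[OF h(3), of 0 s] bounds[of 0] by (cases "s = 0") auto
  qed
  have h1: "h 1 = 1"
  proof -
    obtain s where "s \<in> {0..1}" "h s = 1" using im by (metis atLeastAtMost_iff imageE order_refl zero_le_one)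
    then show ?thesis using strict_mono_onD[OF h(3), of s 1] bounds[of 1] by (cases "s = 1") auto
  qed
  define k where "k t = (if t \<in> {0..1} then h t else t)" for t
  have "strict_mono k"
  proof (rule strict_monoI)
    fix s t :: real assume "s < t"
    then show "k s < k t"
      using strict_mono_onD[OF h(3), of s t] bounds[of s] bounds[of t] by (auto simp: k_def)
  qed
  moreover have "\<exists>t. k t = u" for u
  proof (cases "u \<in> {0..1}")
    case True
    then obtain t where "t \<in> {0..1}" "h t = u" using im by (metis imageE)
    then show ?thesis by (intro exI[of _ t]) (simp add: k_def)
  qed (auto simp: k_def)
  then have "surj k" unfolding surj_def by metis
  moreover have k_id: "k t = t" if "t \<notin> {0<..<1}" for t
    using that h0 h1 by (cases "t = 0 \<or> t = 1") (auto simp: k_def)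
  moreover have "locally_dyadic k t" for t
  proof -
    have h0': "h 0 \<in> dyadic_rationals" using h0 by simp
    have id: "dyadic_affine_on S k" if "S \<inter> {0<..<1} = {}" for S
    proof (rule dyadic_affine_on_translation[of 0])
      show "k t = t + 0" if "t \<in> S" for t
        using k_id[of t] that \<open>S \<inter> {0<..<1} = {}\<close> by (auto simp: disjoint_iff)
    qed simp
    have cong: "dyadic_affine_on S k" if "dyadic_affine_on S h" "S \<subseteq> {0..1}" for S
      using that by (intro dyadic_affine_on_cong[OF that(1)]) (auto simp: k_def)
    consider "t < 0" | "t = 0" | "0 < t" "t < 1" | "t = 1" | "t > 1" by linarith
    then show ?thesis
    proof cases
      case 1
      then show ?thesis by (intro locally_dyadicI_interior[of "t - 1" 0] id) auto
    next
      case 2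
      obtain q where q: "0 < q" "dyadic_affine_on {0..q} h"
        using dyadic_pl_right[OF h(4) h0', of 0] by auto
      \<comment> \<open>Cut off at 1, because \<open>k\<close> agrees with \<open>h\<close> only on
        the unit interval.\<close>
      have "dyadic_affine_on {0..min q 1} k"
        by (intro cong dyadic_affine_on_subset[OF q(2)]) auto
      moreover have "dyadic_affine_on {-1..0} k" by (rule id) auto
      ultimately show ?thesis
        using 2 q(1) locally_dyadicI_dyadic[of "-1" t k "min q 1"] by simp
    next
      case 3
      then show ?thesis
        by (intro locally_dyadic_cong[OF dyadic_pl_interior[OF h(4) h0' 3], of "min t (1 - t)"])
          (auto simp: k_def abs_less_iff)
    next
      case 4
      obtain q where q: "q < 1" "dyadic_affine_on {q..1} h"
        using dyadic_pl_left[OF h(4) h0', of 1] by auto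
      have "dyadic_affine_on {max q 0..1} k"
        by (intro cong dyadic_affine_on_subset[OF q(2)]) auto
      moreover have "dyadic_affine_on {1..2} k" by (rule id) auto
      ultimately show ?thesis
        using 4 q(1) locally_dyadicI_dyadic[of "max q 0" t k 2] by simp
    next
      case 5
      then show ?thesis by (intro locally_dyadicI_interior[of 1 "t + 1"] id) auto
    qed
  qed
  moreover have "g = restrict k {0<..<1}"
    unfolding h(1) by (rule restrict_ext) (auto simp: k_def)
  ultimately show "g \<in> {restrict h {0<..<1} | h. strict_mono h \<and> surj h \<and>
     (\<forall>t. t \<notin> {0<..<1} \<longrightarrow> h t = t) \<and> (\<forall>t. locally_dyadic h t)}" by blast
next
  fix g assume "g \<in> {restrict h {0<..<1} | h. strict_mono h \<and> surj h \<and>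
     (\<forall>t. t \<notin> {0<..<1} \<longrightarrow> h t = t) \<and> (\<forall>t. locally_dyadic h t)}"
  then obtain h where h: "g = restrict h {0<..<1}" "strict_mono h" "surj h"
    "\<And>t. t \<notin> {0<..<1} \<Longrightarrow> h t = t" "\<And>t. locally_dyadic h t" by blast
  have "homeomorphic_map (top_of_set {0..1}) (top_of_set {0..1}) h"
    by (rule homeomorphic_maps_imp_map[OF homeomorphic_maps_strict_mono[OF h(2,3)]])
      (rule fixes_outside_interval_mem_iff(2)[OF h(2,4)])
  moreover have "strict_mono_on {0..1} h" using h(2) by (simp add: strict_mono_on_def strict_mono_def)
  ultimately show "g \<in> thompson_F"
    using h(1) dyadic_pl_if_locally_dyadic[OF h(5)] unfolding thompson_F_def by blast
qed

text \<open>The properties are bundled because the inverse has them with \<open>x\<close> and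
  \<open>y\<close> exchanged, so one conjugation lemma yields both inclusions.\<close>

definition interval_move :: "real \<Rightarrow> real \<Rightarrow> (real \<Rightarrow> real) \<Rightarrow> bool" where
  "interval_move x y f \<longleftrightarrow> strict_mono f \<and> surj f \<and> f x = y \<and>
     (\<forall>t. t \<notin> {0<..<1} \<longrightarrow> f t = t) \<and> (\<forall>t. t \<noteq> x \<longrightarrow> locally_dyadic f t)"

lemma interval_move_inv:
  assumes "interval_move x y f"
  shows "interval_move y x (inv f)"
proof -
  have f: "strict_mono f" "surj f" "f x = y" "\<And>t. t \<notin> {0<..<1} \<Longrightarrow> f t = t"
    "\<And>t. t \<noteq> x \<Longrightarrow> locally_dyadic f t"
    using assms by (auto simp: interval_move_def)
  note inv = strict_mono_inv_real[OF f(1,2)]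
  have "locally_dyadic (inv f) t" if "t \<noteq> y" for t
    using locally_dyadic_inverse[OF f(5) f(1,2), of "inv f t"] that inv(4) f(3) by fastforce
  moreover have "inv f t = t" if "t \<notin> {0<..<1}" for t
    using f(4)[OF that] inv(3) by metis
  moreover have "inv f y = x" using f(3) inv(3) by metis
  ultimately show ?thesis using inv by (simp add: interval_move_def)
qed

lemma thompson_F_conjugate:
  assumes move: "interval_move x y f" and g: "g \<in> nbhd_stabiliser (top_of_set {0<..<1}) thompson_F x"
  shows "restrict (f \<circ> g \<circ> inv f) {0<..<1} \<in> thompson_F"
proof -
  have f: "strict_mono f" "surj f" "f x = y" "\<And>t. t \<notin> {0<..<1} \<Longrightarrow> f t = t"
    "\<And>t. t \<noteq> x \<Longrightarrow> locally_dyadic f t"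
    using move by (auto simp: interval_move_def)
  note inv = strict_mono_inv_real[OF f(1,2)]
  have inv_id: "inv f t = t" if "t \<notin> {0<..<1}" for t
    using f(4)[OF that] inv(3) by metis
  obtain h where h: "g = restrict h {0<..<1}" "strict_mono h" "surj h"
    "\<And>t. t \<notin> {0<..<1} \<Longrightarrow> h t = t" "\<And>t. locally_dyadic h t"
    using g by (auto simp: nbhd_stabiliser_def thompson_F_eq)
  obtain U where U: "openin (top_of_set {0<..<1}) U" "x \<in> U" "\<And>t. t \<in> U \<Longrightarrow> g t = t"
    using g by (auto simp: nbhd_stabiliser_def)
  have "open U" "U \<subseteq> {0<..<1}" using U(1) by (auto simp: openin_open_eq)
  then have hU: "h t = t" if "t \<in> U" for t using U(3)[OF that] that by (auto simp: h(1))
  define k where "k = f \<circ> h \<circ> inv f"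
  have "strict_mono k" unfolding k_def using f h inv by (simp add: strict_mono_def)
  moreover have "surj k" unfolding k_def using f h inv by (intro comp_surj)
  moreover have "k t = t" if "t \<notin> {0<..<1}" for t
    using that f(4) h(4) inv_id by (simp add: k_def)
  moreover have "locally_dyadic k t" for t
  proof (cases "inv f t = x")
    case False
    moreover have "h (inv f t) \<noteq> x"
      using False hU[OF U(2)] strict_mono_eq[OF h(2)] by metis
    ultimately show ?thesis
      unfolding k_def using f h by (intro locally_dyadic_conjugate) auto
  next
    case True
    have "open (inv f -` U)"
      using \<open>open U\<close> strict_mono_inv_real(5)[OF inv(1,2)] by (simp add: continuous_on_open_vimage)
    then obtain e where e: "e > 0" "\<And>s. \<bar>s - t\<bar> < e \<Longrightarrow> inv f s \<in> U"
      using True U(2) unfolding open_real by (metis vimageD vimageI2)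
    \<comment> \<open>The identity is written as the translation by 0, which is already known to be
      locally dyadic.\<close>
    have "s + 0 = k s" if "\<bar>s - t\<bar> < e" for s
      using hU[OF e(2)[OF that]] inv(4) by (simp add: k_def)
    then show ?thesis
      using locally_dyadic_cong[OF locally_dyadic_translation[of 0 t] e(1), of k] by simp
  qed
  moreover have "restrict (f \<circ> g \<circ> inv f) {0<..<1} = restrict k {0<..<1}"
  proof (rule restrict_ext)
    fix t :: real assume "t \<in> {0<..<1}"
    then have "inv f t \<in> {0<..<1}"
      using fixes_outside_interval_mem_iff(1)[OF inv(1) inv_id] by blast
    then show "(f \<circ> g \<circ> inv f) t = k t" by (simp add: h(1) k_def)
  qed
  ultimately show ?thesis unfolding thompson_F_eq by blast
qed

lemma conjugate_nbhd_stabiliser_F: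
  assumes "x \<in> {0<..<1}" "y \<in> {0<..<1}"
  shows "\<exists>f. homeomorphic_map (top_of_set {0<..<1}) (top_of_set {0<..<1}) f \<and>
    conjugate_by (top_of_set {0<..<1}) f (nbhd_stabiliser (top_of_set {0<..<1}) thompson_F x)
    = nbhd_stabiliser (top_of_set {0<..<1}) thompson_F y"
proof -
  obtain f where f: "strict_mono f" "surj f" "f x = y" "\<And>t. t \<notin> {0<..<1} \<Longrightarrow> f t = t"
    "\<And>t. t \<noteq> x \<Longrightarrow> locally_dyadic f t"
    by (rule locally_dyadic_off_point[of x y]) (use assms in auto)
  then have move: "interval_move x y f" by (simp add: interval_move_def)
  note move' = interval_move_inv[OF move]
  have maps: "homeomorphic_maps (top_of_set {0<..<1}) (top_of_set {0<..<1}) f (inv f)"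
    by (rule homeomorphic_maps_strict_mono[OF f(1,2) fixes_outside_interval_mem_iff(1)[OF f(1,4)]])
  have inv_inv: "inv (inv f) = f"
    using f(1,2) strict_mono_imp_inj_on by (intro inv_inv_eq bijI)
  have "conjugate_by (top_of_set {0<..<1}) f (nbhd_stabiliser (top_of_set {0<..<1}) thompson_F x)
    = nbhd_stabiliser (top_of_set {0<..<1}) thompson_F y"
  proof (rule conjugate_by_nbhd_stabiliser[OF maps _ f(3)])
    show "thompson_F \<subseteq> extensional (topspace (top_of_set {0<..<1}))"
      by (auto simp: thompson_F_eq)
    show "g ` topspace (top_of_set {0<..<1}) \<subseteq> topspace (top_of_set {0<..<1})" if "g \<in> thompson_F" for g
    proof -
      obtain h where h: "g = restrict h {0<..<1}" "strict_mono h" "\<And>t. t \<notin> {0<..<1} \<Longrightarrow> h t = t"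
        using \<open>g \<in> thompson_F\<close> unfolding thompson_F_eq by blast
      have "g t \<in> {0<..<1}" if "t \<in> {0<..<1}" for t
        unfolding h(1) restrict_apply'[OF that]
        by (rule iffD2[OF fixes_outside_interval_mem_iff(1)[OF h(2,3)] that])
      then show ?thesis by (simp add: image_subset_iff)
    qed
    show "restrict (f \<circ> g \<circ> inv f) (topspace (top_of_set {0<..<1})) \<in> thompson_F"
      if "g \<in> nbhd_stabiliser (top_of_set {0<..<1}) thompson_F x" for g
      using thompson_F_conjugate[OF move that] by simp
    show "restrict (inv f \<circ> g \<circ> f) (topspace (top_of_set {0<..<1})) \<in> thompson_F"
      if "g \<in> nbhd_stabiliser (top_of_set {0<..<1}) thompson_F y" for g
      using thompson_F_conjugate[OF move' that] by (simp add: inv_inv)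
  qed (use assms in simp)
  then show ?thesis using homeomorphic_maps_imp_map[OF maps] by blast
qed


section \<open>Thompson's group \<open>T\<close>\<close>

lemma shift_of_int:
  fixes f :: "real \<Rightarrow> real"
  assumes "\<And>t. f (t + 1) = f t + 1"
  shows "f (t + of_int k) = f t + of_int k"
proof (induction k rule: int_induct[where k = 0])
  case (step1 i)
  then show ?case using assms[of "t + of_int i"] by (simp add: add.assoc)
next
  case (step2 i)
  then show ?case using assms[of "t + of_int (i - 1)"] by (simp add: algebra_simps)
qed simp

lemma dyadic_rationals_Ints: "t \<in> \<int> \<Longrightarrow> t \<in> dyadic_rationals"
  by (auto elim: Ints_cases)

text \<open>Descent to the quotient through an arbitrary representative; the choice does not matter
  when \<open>f\<close> commutes with the translation by 1.\<close>

definition circle_map :: "(real \<Rightarrow> real) \<Rightarrow> real set \<Rightarrow> real set" where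
  "circle_map f p = circle_proj (f (SOME t. circle_proj t = p))"

lemma circle_map_proj:
  assumes "\<And>t. f (t + 1) = f t + 1"
  shows "circle_map f (circle_proj s) = circle_proj (f s)"
proof -
  define t where "t = (SOME t. circle_proj t = circle_proj s)"
  have "circle_proj t = circle_proj s" unfolding t_def by (rule someI) simp
  then obtain k :: int where "t - s = of_int k"
    by (auto simp: circle_proj_eq_iff elim: Ints_cases)
  then have "t = s + of_int k" by simp
  then have "f t = f s + of_int k" using shift_of_int[of f] assms by simp
  then have "circle_proj (f t) = circle_proj (f s)" by (simp add: circle_proj_eq_iff)
  then show ?thesis unfolding circle_map_def t_def .
qed

text \<open>The analogue of \<open>interval_move\<close> for lifts: periodicity spreads the bad
  point over the whole class of \<open>x\<close> modulo 1.\<close>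

definition circle_move :: "real \<Rightarrow> real \<Rightarrow> (real \<Rightarrow> real) \<Rightarrow> bool" where
  "circle_move x y f \<longleftrightarrow> strict_mono f \<and> surj f \<and> f x = y \<and>
     (\<forall>t. f (t + 1) = f t + 1) \<and> (\<forall>t. t - x \<notin> \<int> \<longrightarrow> locally_dyadic f t)"

lemma circle_move_inv:
  assumes "circle_move x y f"
  shows "circle_move y x (inv f)"
proof -
  have f: "strict_mono f" "surj f" "f x = y" "\<And>t. f (t + 1) = f t + 1"
    "\<And>t. t - x \<notin> \<int> \<Longrightarrow> locally_dyadic f t"
    using assms by (auto simp: circle_move_def)
  note inv = strict_mono_inv_real[OF f(1,2)]
  have "inv f (t + 1) = inv f t + 1" for t
    using f(4)[of "inv f t"] inv(3,4) by metis
  moreover have "locally_dyadic (inv f) t" if "t - y \<notin> \<int>" for t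
  proof -
    have "inv f t - x \<notin> \<int>"
    proof
      assume "inv f t - x \<in> \<int>"
      then obtain k :: int where "inv f t - x = of_int k" by (auto elim: Ints_cases)
      then have "inv f t = x + of_int k" by simp
      then have "t = y + of_int k" using shift_of_int[of f x k] f(3,4) inv(4) by metis
      then show False using that by simp
    qed
    then show ?thesis using locally_dyadic_inverse[OF f(5) f(1,2), of "inv f t"] inv(4) by simp
  qed
  moreover have "inv f y = x" using f(3) inv(3) by metis
  ultimately show ?thesis using inv by (simp add: circle_move_def)
qed

lemma homeomorphic_maps_circle_map:
  assumes f: "strict_mono f" "surj f" "\<And>t. f (t + 1) = f t + 1"
  shows "homeomorphic_maps circle circle (circle_map f) (circle_map (inv f))"
proof -
  note inv = strict_mono_inv_real[OF f(1,2)]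
  have inv1: "inv f (t + 1) = inv f t + 1" for t
    using f(3)[of "inv f t"] inv(3,4) by metis
  have cont: "continuous_map circle circle (circle_map h)"
    if "continuous_on UNIV h" "\<And>t. h (t + 1) = h t + 1" for h
  proof (rule continuous_compose_quotient_map[OF quotient_map_circle_proj])
    have "continuous_map euclidean circle (circle_proj \<circ> h)"
      using that(1) quotient_imp_continuous_map[OF quotient_map_circle_proj]
      by (intro continuous_map_compose[of _ euclidean]) auto
    moreover have "circle_map h \<circ> circle_proj = circle_proj \<circ> h"
      using circle_map_proj[of h] that(2) by auto
    ultimately show "continuous_map euclidean circle (circle_map h \<circ> circle_proj)" by simp
  qed
  have "continuous_on UNIV (inv f)" using strict_mono_inv_real(5) inv(1,2) by blast
  then show ?thesis
    using cont inv f(3) inv1 circle_map_proj[of f] circle_map_proj[of "inv f"]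
    by (auto simp: homeomorphic_maps_def topspace_circle)
qed

text \<open>\<open>dyadic_pl 0 1 h\<close> describes one period only; the behaviour at integers
  comes from gluing the last piece, shifted by -1, to the first. That dyadic points go to dyadic
  points makes \<open>h 0\<close> dyadic, which starts the propagation in
  \<open>dyadic_pl_pieces\<close>.\<close>

lemma thompson_T_eq:
  "thompson_T = {g \<in> extensional (topspace circle). homeomorphic_map circle circle g \<and>
     (\<exists>h. strict_mono h \<and> (\<forall>t. h (t + 1) = h t + 1) \<and> (\<forall>t. locally_dyadic h t) \<and>
       (\<forall>t. g (circle_proj t) = circle_proj (h t)))}"
proof (intro equalityI subsetI)
  fix g assume "g \<in> thompson_T"
  then obtain h where g: "g \<in> extensional (topspace circle)" "homeomorphic_map circle circle g"
    "g ` circle_proj ` dyadic_rationals \<subseteq> circle_proj ` dyadic_rationals"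
    and h: "strict_mono h" "\<And>t. h (t + 1) = h t + 1" "\<And>t. g (circle_proj t) = circle_proj (h t)"
      "dyadic_pl 0 1 h"
    unfolding thompson_T_def orientation_preserving_lift_def by blast
  have h0: "h 0 \<in> dyadic_rationals"
  proof -
    have "circle_proj (h 0) \<in> circle_proj ` dyadic_rationals"
      using g(3) h(3)[of 0] by (metis dyadic_rationals_0_1(1) image_eqI subset_eq)
    then obtain d where d: "d \<in> dyadic_rationals" "h 0 - d \<in> \<int>"
      by (auto simp: circle_proj_eq_iff)
    then have "(h 0 - d) + d \<in> dyadic_rationals"
      by (blast intro: dyadic_rationals_add dyadic_rationals_Ints)
    then show ?thesis by simp
  qed
  have h_at_0: "locally_dyadic h 0"
  proof -
    obtain q where q: "0 < q" "dyadic_affine_on {0..q} h"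
      using dyadic_pl_right[OF h(4) h0, of 0] by auto
    obtain p where p: "p < 1" "dyadic_affine_on {p..1} h"
      using dyadic_pl_left[OF h(4) h0, of 1] by auto
    obtain k c where kc: "c \<in> dyadic_rationals" "\<And>t. t \<in> {p..1} \<Longrightarrow> h t = 2 powi (k::int) * t + c"
      using p(2) unfolding dyadic_affine_on_def by blast
    have "dyadic_affine_on {p - 1..0} h"
    proof (rule dyadic_affine_onI)
      \<comment> \<open>The constant comes from \<open>h t = h (t + 1) - 1\<close>, with
        \<open>t + 1\<close> in the last piece.\<close>
      show "2 powi k + c - 1 \<in> dyadic_rationals"
        by (intro dyadic_rationals_intros dyadic_rationals_powi kc) simp
      show "h t = 2 powi k * t + (2 powi k + c - 1)" if "t \<in> {p - 1..0}" for t
        using kc(2)[of "t + 1"] h(2)[of t] that by (simp add: algebra_simps)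
    qed
    then show ?thesis using p q by (intro locally_dyadicI_dyadic[of "p - 1" 0 h q]) auto
  qed
  have "locally_dyadic h t" for t
  proof -
    have frac: "locally_dyadic h (frac t)"
    proof (cases "frac t = 0")
      case False
      then show ?thesis
        using frac_ge_0[of t] frac_lt_1[of t] by (intro dyadic_pl_interior[OF h(4) h0]) auto
    qed (use h_at_0 in metis)
    have "locally_dyadic (\<lambda>s. h (s - of_int \<lfloor>t\<rfloor>) + of_int \<lfloor>t\<rfloor>) t"
      using frac by (intro locally_dyadic_conj_translation) (auto simp: frac_def)
    moreover have "h (s - of_int \<lfloor>t\<rfloor>) + of_int \<lfloor>t\<rfloor> = h s" for s
      using shift_of_int[of h "s - of_int \<lfloor>t\<rfloor>" "\<lfloor>t\<rfloor>"] h(2) by simp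
    ultimately show ?thesis by simp
  qed
  then show "g \<in> {g \<in> extensional (topspace circle). homeomorphic_map circle circle g \<and>
     (\<exists>h. strict_mono h \<and> (\<forall>t. h (t + 1) = h t + 1) \<and> (\<forall>t. locally_dyadic h t) \<and>
       (\<forall>t. g (circle_proj t) = circle_proj (h t)))}"
    using g h by blast
next
  fix g assume "g \<in> {g \<in> extensional (topspace circle). homeomorphic_map circle circle g \<and>
     (\<exists>h. strict_mono h \<and> (\<forall>t. h (t + 1) = h t + 1) \<and> (\<forall>t. locally_dyadic h t) \<and>
       (\<forall>t. g (circle_proj t) = circle_proj (h t)))}"
  then obtain h where g: "g \<in> extensional (topspace circle)" "homeomorphic_map circle circle g"
    and h: "strict_mono h" "\<And>t. h (t + 1) = h t + 1" "\<And>t. locally_dyadic h t"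
      "\<And>t. g (circle_proj t) = circle_proj (h t)" by blast
  have "continuous_on UNIV h"
    using locally_dyadic_isCont[OF h(3)] by (simp add: continuous_at_imp_continuous_on)
  then have "orientation_preserving_lift g h"
    using h by (simp add: orientation_preserving_lift_def)
  moreover have "g ` circle_proj ` dyadic_rationals \<subseteq> circle_proj ` dyadic_rationals"
    using h(4) locally_dyadic_dyadic_iff[OF h(3)] by auto
  ultimately show "g \<in> thompson_T"
    using g dyadic_pl_if_locally_dyadic[OF h(3)] unfolding thompson_T_def by blast
qed

text \<open>The map \<open>f \<circ> h \<circ> inv f\<close> is a lift of the conjugate. A lift of
  an element trivial near a point is there an integer translation, not necessarily the identity, and
  \<open>f\<close> commutes with it.\<close>

lemma thompson_T_conjugate:
  assumes move: "circle_move x y f" and g: "g \<in> nbhd_stabiliser circle thompson_T (circle_proj x)"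
  shows "restrict (circle_map f \<circ> g \<circ> circle_map (inv f)) (topspace circle) \<in> thompson_T"
proof -
  have f: "strict_mono f" "surj f" "f x = y" "\<And>t. f (t + 1) = f t + 1"
    "\<And>t. t - x \<notin> \<int> \<Longrightarrow> locally_dyadic f t"
    using move by (auto simp: circle_move_def)
  note inv = strict_mono_inv_real[OF f(1,2)]
  have inv1: "inv f (t + 1) = inv f t + 1" for t
    using f(4)[of "inv f t"] inv(3,4) by metis
  obtain h where g_hom: "homeomorphic_map circle circle g"
    and h: "strict_mono h" "\<And>t. h (t + 1) = h t + 1" "\<And>t. locally_dyadic h t"
      "\<And>t. g (circle_proj t) = circle_proj (h t)"
    using g by (auto simp: nbhd_stabiliser_def thompson_T_eq)
  obtain U where U: "openin circle U" "circle_proj x \<in> U" "\<And>p. p \<in> U \<Longrightarrow> g p = p"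
    using g by (auto simp: nbhd_stabiliser_def)
  have h_int: "h t - t \<in> \<int>" if "circle_proj t \<in> U" for t
    using U(3)[OF that] h(4)[of t] by (simp add: circle_proj_eq_iff)
  obtain m :: int where m: "h x - x = of_int m" using h_int[OF U(2)] by (auto elim: Ints_cases)
  have "open (circle_proj -` U)" using U(1) by (simp add: openin_circle)
  then obtain d where d: "d > 0" "\<And>t. \<bar>t - x\<bar> < d \<Longrightarrow> circle_proj t \<in> U"
    using U(2) unfolding open_real by (metis vimageD vimageI2)
  have "isCont (\<lambda>t. h t - t) x"
    using locally_dyadic_isCont[OF h(3)] by (intro continuous_intros)
  then obtain d' where d': "d' > 0" "\<And>t. \<bar>t - x\<bar> < d' \<Longrightarrow> \<bar>(h t - t) - (h x - x)\<bar> < 1"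
    unfolding continuous_at_eps_delta dist_real_def by (metis zero_less_one)
  text \<open>Near \<open>x\<close> the lift \<open>h\<close> of \<open>g\<close> differs from the identity by an integer, which is constant by continuity.\<close>
  have near: "h t = t + of_int m" if t: "\<bar>t - x\<bar> < min d d'" for t
  proof -
    have "h t - t \<in> \<int>" using t by (intro h_int d(2)) simp
    then obtain j :: int where j: "h t - t = of_int j" by (auto elim: Ints_cases)
    have "\<bar>of_int j - of_int m :: real\<bar> < 1" using d'(2)[of t] t j m by simp
    then have "j = m" by linarith
    then show ?thesis using j by simp
  qed
  define k where "k = f \<circ> h \<circ> inv f"
  have "strict_mono k" unfolding k_def using f h inv by (simp add: strict_mono_def)
  moreover have "k (t + 1) = k t + 1" for t by (simp add: k_def inv1 h f)
  moreover have "locally_dyadic k t" for t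
  proof (cases "inv f t - x \<in> \<int>")
    case False
    moreover have "h (inv f t) - x \<notin> \<int>"
    proof
      assume "h (inv f t) - x \<in> \<int>"
      then obtain j :: int where "h (inv f t) - x = of_int j" by (auto elim: Ints_cases)
      then have "h (inv f t) = h x + of_int (j - m)" using m by simp
      also have "\<dots> = h (x + of_int (j - m))" using shift_of_int[of h x "j - m"] h(2) by simp
      finally have "inv f t = x + of_int (j - m)" using strict_mono_eq[OF h(1)] by blast
      then show False using False by simp
    qed
    ultimately show ?thesis
      unfolding k_def using f h by (intro locally_dyadic_conjugate) auto
  next
    case True
    then obtain n :: int where n: "inv f t - x = of_int n" by (auto elim: Ints_cases)
    have "isCont (inv f) t"
      using strict_mono_inv_real(5)[OF inv(1,2)] by (simp add: continuous_on_eq_continuous_at)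
    then obtain e where e: "e > 0" "\<And>s. \<bar>s - t\<bar> < e \<Longrightarrow> \<bar>inv f s - inv f t\<bar> < min d d'"
      using d(1) d'(1) unfolding continuous_at_eps_delta dist_real_def by (metis min_less_iff_conj)
    \<comment> \<open>The point \<open>inv f s\<close> is near \<open>x + n\<close> with an integer
      \<open>n\<close>; shifting it by \<open>- n\<close> brings it near \<open>x\<close>, where
      \<open>near\<close> applies.\<close>
    have "s + of_int m = k s" if "\<bar>s - t\<bar> < e" for s
    proof -
      have "\<bar>(inv f s - of_int n) - x\<bar> < min d d'" using e(2)[OF that] n by (simp add: algebra_simps)
      then have "h (inv f s - of_int n) = inv f s - of_int n + of_int m" by (rule near)
      then have "h (inv f s) = inv f s + of_int m"
        using shift_of_int[of h "inv f s - of_int n" n] h(2) by simp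
      then show ?thesis using shift_of_int[of f "inv f s" m] f(4) inv(4) by (simp add: k_def)
    qed
    then show ?thesis
      by (intro locally_dyadic_cong[OF locally_dyadic_translation[of "of_int m" t] e(1)]) auto
  qed
  moreover have "restrict (circle_map f \<circ> g \<circ> circle_map (inv f)) (topspace circle) (circle_proj t) =
      circle_proj (k t)" for t
    using circle_map_proj[of f] circle_map_proj[of "inv f"] f(4) inv1 h(4)
    by (simp add: topspace_circle k_def)
  moreover have "homeomorphic_map circle circle
      (restrict (circle_map f \<circ> g \<circ> circle_map (inv f)) (topspace circle))"
  proof (rule homeomorphic_map_eq)
    have "homeomorphic_map circle circle (circle_map f)" "homeomorphic_map circle circle (circle_map (inv f))"
      using homeomorphic_maps_circle_map[OF f(1,2,4)] homeomorphic_maps_map by blast+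
    then show "homeomorphic_map circle circle (circle_map f \<circ> g \<circ> circle_map (inv f))"
      using g_hom homeomorphic_map_compose by blast
  qed simp
  ultimately show ?thesis unfolding thompson_T_eq by blast
qed

text \<open>Copies of \<open>f\<close> on the unit intervals fit together because \<open>f\<close>
  fixes 0 and 1. Integers are good points, since the bad point lies strictly between 0 and
  1.\<close>

lemma periodic_extension:
  assumes f: "strict_mono f" "surj f" "\<And>t. t \<notin> {0<..<1} \<Longrightarrow> f t = t"
    and ld: "\<And>t. t \<noteq> x \<Longrightarrow> locally_dyadic f t" and x: "0 < x" "x < 1"
  defines "F \<equiv> \<lambda>t. f (frac t) + of_int \<lfloor>t\<rfloor>"
  shows "strict_mono F" "surj F" "F (t + 1) = F t + 1" "frac t \<noteq> x \<Longrightarrow> locally_dyadic F t"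
proof -
  note inv = strict_mono_inv_real[OF f(1,2)]
  have f01: "f 0 = 0" "f 1 = 1" using f(3) by auto
  have range: "0 \<le> f (frac t)" "f (frac t) < 1" for t
    using strict_mono_less_eq[OF f(1), of 0 "frac t"] strict_mono_less[OF f(1), of "frac t" 1]
      f01 frac_lt_1[of t] by auto
  show "strict_mono F"
  proof (rule strict_monoI)
    fix s t :: real assume st: "s < t"
    show "F s < F t"
    proof (cases "\<lfloor>s\<rfloor> = \<lfloor>t\<rfloor>")
      case True
      then have "frac s < frac t" using st by (simp add: frac_def)
      then show ?thesis using True strict_monoD[OF f(1)] by (simp add: F_def)
    next
      case False
      then have "\<lfloor>s\<rfloor> + 1 \<le> \<lfloor>t\<rfloor>" using floor_mono[of s t] st by linarith
      then have "of_int \<lfloor>s\<rfloor> + 1 \<le> (of_int \<lfloor>t\<rfloor> :: real)" by linarith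
      then show ?thesis using range(2)[of s] range(1)[of t] by (simp add: F_def)
    qed
  qed
  have "\<exists>t. F t = u" for u
  proof -
    have "0 \<le> inv f (frac u)" "inv f (frac u) < 1"
      using strict_mono_less_eq[OF inv(1), of 0 "frac u"] strict_mono_less[OF inv(1), of "frac u" 1]
        f01 inv(3)[of 0] inv(3)[of 1] frac_lt_1[of u] by auto
    then have "\<lfloor>inv f (frac u) + of_int \<lfloor>u\<rfloor>\<rfloor> = \<lfloor>u\<rfloor>"
      by (simp add: floor_eq_iff)
    then have "F (inv f (frac u) + of_int \<lfloor>u\<rfloor>) = u"
      using inv(4) by (simp add: F_def frac_def)
    then show ?thesis by blast
  qed
  then show "surj F" unfolding surj_def by metis
  show "F (t + 1) = F t + 1" by (simp add: F_def frac_def)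
  \<comment> \<open>The right endpoint is included, so that the piece to the left of an integer can
    be used up to that integer.\<close>
  have piece: "F s = f (s - of_int n) + of_int n" if "of_int n \<le> s" "s \<le> of_int n + 1" for s and n :: int
  proof (cases "s = of_int n + 1")
    case True
    then show ?thesis by (simp add: F_def f01)
  next
    case False
    then have "\<lfloor>s\<rfloor> = n" using that by (simp add: floor_eq_iff)
    then show ?thesis by (simp add: F_def frac_def)
  qed
  have ld_shift: "locally_dyadic (\<lambda>s. f (s - of_int n) + of_int n) t" if "t - of_int n \<noteq> x" for n :: int and t
    using ld[OF that] by (intro locally_dyadic_conj_translation) auto
  show "locally_dyadic F t" if "frac t \<noteq> x"
  proof (cases "frac t = 0")
    case False
    let ?n = "\<lfloor>t\<rfloor>"
    have ft: "0 < frac t" "frac t < 1" "frac t = t - of_int ?n"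
      using False frac_lt_1[of t] frac_ge_0[of t] frac_def[of t] by linarith+
    show ?thesis
    proof (rule locally_dyadic_cong[OF ld_shift[of t ?n]])
      show "min (frac t) (1 - frac t) > 0" using ft by simp
      show "f (s - of_int ?n) + of_int ?n = F s" if "\<bar>s - t\<bar> < min (frac t) (1 - frac t)" for s
        using piece[of ?n s] that ft by (auto simp: abs_less_iff)
    qed (use that ft in simp)
  next
    case True
    then obtain n :: int where n: "t = of_int n" by (auto elim: Ints_cases simp: frac_eq_0_iff)
    obtain e where e: "e > 0" "dyadic_affine_on {t..t + e} (\<lambda>s. f (s - of_int n) + of_int n)"
      using ld_shift[of t n] x n unfolding locally_dyadic_def by auto
    obtain e' where e': "e' > 0" "dyadic_affine_on {t - e'..t} (\<lambda>s. f (s - of_int (n - 1)) + of_int (n - 1))"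
      using ld_shift[of t "n - 1"] x n unfolding locally_dyadic_def by auto
    have "dyadic_affine_on {t..t + min e 1} F"
      by (rule dyadic_affine_on_cong[OF dyadic_affine_on_subset[OF e(2)]])
        (use piece[of n] n in auto)
    moreover have "dyadic_affine_on {t - min e' 1..t} F"
      by (rule dyadic_affine_on_cong[OF dyadic_affine_on_subset[OF e'(2)]])
        (use piece[of "n - 1"] n in auto)
    ultimately show ?thesis
      using e(1) e'(1) n by (intro locally_dyadicI_dyadic[of "t - min e' 1" t F "t + min e 1"]) auto
  qed
qed

text \<open>The circle is cut open at a dyadic point \<open>d\<close> that represents neither
  \<open>x\<close> nor \<open>y\<close>; on the resulting interval the construction for F applies.
  Three candidates suffice, being pairwise incongruent modulo 1: each of \<open>x\<close> and
  \<open>y\<close> excludes at most one.\<close>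

lemma circle_move_exists: "\<exists>f. circle_move x y f"
proof -
  have one: "d = d'" if "z - d \<in> \<int>" "z - d' \<in> \<int>" "d \<in> {0, 1/2, 1/4}" "d' \<in> {0, 1/2, 1/4}" for z d d' :: real
  proof -
    have "d - d' \<in> \<int>" using Ints_diff[OF that(2,1)] by simp
    then obtain j :: int where j: "d - d' = of_int j" by (auto elim: Ints_cases)
    moreover have "\<bar>d - d'\<bar> < 1" using that(3,4) by auto
    ultimately have "j = 0" by linarith
    then show ?thesis using j by simp
  qed
  have "\<exists>d\<in>{0, 1/2, 1/4}. x - d \<notin> \<int> \<and> y - d \<notin> \<int>"
  proof (rule ccontr)
    assume "\<not> ?thesis"
    then have *: "x - d \<in> \<int> \<or> y - d \<in> \<int>" if "d \<in> {0, 1/2, 1/4}" for d using that by blast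
    show False using *[of 0] *[of "1/2"] *[of "1/4"] one[of x 0 "1/2"] one[of x 0 "1/4"]
      one[of x "1/2" "1/4"] one[of y 0 "1/2"] one[of y 0 "1/4"] one[of y "1/2" "1/4"] by auto
  qed
  then obtain d where d: "d \<in> {0, 1/2, 1/4}" "x - d \<notin> \<int>" "y - d \<notin> \<int>" by blast
  have dD: "d \<in> dyadic_rationals"
  proof -
    have "{0, 1/2, 1/4} \<subseteq> dyadic_rationals"
      using dyadic_rationals_divide_power[of 1 1] dyadic_rationals_divide_power[of 1 2] by simp
    then show ?thesis using d(1) by blast
  qed
  have fr: "0 < frac (x - d)" "frac (x - d) < 1" "0 < frac (y - d)" "frac (y - d) < 1"
    using d frac_ge_0[of "x - d"] frac_ge_0[of "y - d"] frac_lt_1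
    by (auto simp: less_le)
  obtain f where f: "strict_mono f" "surj f" "f (frac (x - d)) = frac (y - d)"
    "\<And>t. t \<notin> {0<..<1} \<Longrightarrow> f t = t" "\<And>t. t \<noteq> frac (x - d) \<Longrightarrow> locally_dyadic f t"
    by (rule locally_dyadic_off_point[OF fr]) blast
  define F where "F t = f (frac t) + of_int \<lfloor>t\<rfloor>" for t
  have F: "strict_mono F" "surj F" "\<And>t. F (t + 1) = F t + 1"
    "\<And>t. frac t \<noteq> frac (x - d) \<Longrightarrow> locally_dyadic F t"
    using periodic_extension[OF f(1,2,4,5) fr(1,2)] unfolding F_def by blast+
  \<comment> \<open>The integer part makes \<open>G x = y\<close> hold exactly, not only modulo
    1.\<close>
  define c where "c = d + of_int (\<lfloor>y - d\<rfloor> - \<lfloor>x - d\<rfloor>)"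
  have cD: "c \<in> dyadic_rationals" unfolding c_def by (rule dyadic_rationals_add[OF dD dyadic_rationals_of_int])
  define G where "G t = F (t - d) + c" for t
  have "strict_mono G" using F(1) by (simp add: G_def strict_mono_def)
  moreover have "\<exists>t. G t = u" for u
  proof -
    obtain t where "F t = u - c" using F(2) by (metis surj_def)
    then show ?thesis by (intro exI[of _ "t + d"]) (simp add: G_def)
  qed
  then have "surj G" unfolding surj_def by metis
  moreover have "G x = y" by (simp add: G_def F_def f c_def) (simp add: frac_def)
  moreover have "G (t + 1) = G t + 1" for t using F(3)[of "t - d"] by (simp add: G_def algebra_simps)
  moreover have "locally_dyadic G t" if "t - x \<notin> \<int>" for t
  proof -
    have "frac (t - d) \<noteq> frac (x - d)"
    proof
      assume "frac (t - d) = frac (x - d)"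
      then have "t - x = of_int (\<lfloor>t - d\<rfloor> - \<lfloor>x - d\<rfloor>)" by (simp add: frac_def)
      then show False using that by (metis Ints_of_int)
    qed
    then show ?thesis unfolding G_def by (intro locally_dyadic_conj_translation F dD cD)
  qed
  ultimately show ?thesis unfolding circle_move_def by blast
qed

lemma conjugate_nbhd_stabiliser_T:
  assumes "p \<in> topspace circle" "q \<in> topspace circle"
  shows "\<exists>f. homeomorphic_map circle circle f \<and>
    conjugate_by circle f (nbhd_stabiliser circle thompson_T p) = nbhd_stabiliser circle thompson_T q"
proof -
  obtain x y where p: "p = circle_proj x" and q: "q = circle_proj y"
    using assms by (auto simp: topspace_circle)
  obtain f where move: "circle_move x y f" using circle_move_exists by blast
  then have f: "strict_mono f" "surj f" "f x = y" "\<And>t. f (t + 1) = f t + 1"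
    by (auto simp: circle_move_def)
  note move' = circle_move_inv[OF move]
  have maps: "homeomorphic_maps circle circle (circle_map f) (circle_map (inv f))"
    by (rule homeomorphic_maps_circle_map[OF f(1,2)]) (rule f(4))
  have inv_inv: "inv (inv f) = f"
    using f(1,2) strict_mono_imp_inj_on by (intro inv_inv_eq bijI)
  have "circle_map f p = q" using circle_map_proj[of f x] f(3,4) p q by simp
  have "conjugate_by circle (circle_map f) (nbhd_stabiliser circle thompson_T p)
    = nbhd_stabiliser circle thompson_T q"
  proof (rule conjugate_by_nbhd_stabiliser[OF maps assms(1) \<open>circle_map f p = q\<close>])
    show "thompson_T \<subseteq> extensional (topspace circle)"
      by (auto simp: thompson_T_def)
    show "g ` topspace circle \<subseteq> topspace circle" if "g \<in> thompson_T" for g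
      using that homeomorphic_imp_surjective_map[of circle circle g] by (simp add: thompson_T_def)
    show "restrict (circle_map f \<circ> g \<circ> circle_map (inv f)) (topspace circle) \<in> thompson_T"
      if "g \<in> nbhd_stabiliser circle thompson_T p" for g
      using thompson_T_conjugate[OF move] that p by blast
    show "restrict (circle_map (inv f) \<circ> g \<circ> circle_map f) (topspace circle) \<in> thompson_T"
      if "g \<in> nbhd_stabiliser circle thompson_T q" for g
      using thompson_T_conjugate[OF move'] that q unfolding inv_inv by blast
  qed
  then show ?thesis using homeomorphic_maps_imp_map[OF maps] by blast
qed

theorem corollary3p3:
  shows "(\<forall>x\<in>{0<..<1}. \<forall>y\<in>{0<..<1}.
            \<exists>f. homeomorphic_map (top_of_set {0<..<1}) (top_of_set {0<..<1}) f \<and>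
              conjugate_by (top_of_set {0<..<1}) f
                (nbhd_stabiliser (top_of_set {0<..<1}) thompson_F x)
              = nbhd_stabiliser (top_of_set {0<..<1}) thompson_F y) \<and>
         (\<forall>x\<in>topspace circle. \<forall>y\<in>topspace circle.
            \<exists>f. homeomorphic_map circle circle f \<and>
              conjugate_by circle f (nbhd_stabiliser circle thompson_T x)
              = nbhd_stabiliser circle thompson_T y) \<and>
         (\<forall>x\<in>topspace cantor_space. \<forall>y\<in>topspace cantor_space.
            \<exists>f. homeomorphic_map cantor_space cantor_space f \<and>
              conjugate_by cantor_space f (nbhd_stabiliser cantor_space thompson_V x)
              = nbhd_stabiliser cantor_space thompson_V y)"
proof (intro conjI ballI)
  fix x y :: real assume "x \<in> {0<..<1}" "y \<in> {0<..<1}"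
  then show "\<exists>f. homeomorphic_map (top_of_set {0<..<1}) (top_of_set {0<..<1}) f \<and>
      conjugate_by (top_of_set {0<..<1}) f (nbhd_stabiliser (top_of_set {0<..<1}) thompson_F x)
      = nbhd_stabiliser (top_of_set {0<..<1}) thompson_F y"
    by (rule conjugate_nbhd_stabiliser_F)
next
  fix x y assume "x \<in> topspace circle" "y \<in> topspace circle"
  then show "\<exists>f. homeomorphic_map circle circle f \<and>
      conjugate_by circle f (nbhd_stabiliser circle thompson_T x) = nbhd_stabiliser circle thompson_T y"
    by (rule conjugate_nbhd_stabiliser_T)
next
  fix x y
  show "\<exists>f. homeomorphic_map cantor_space cantor_space f \<and>
      conjugate_by cantor_space f (nbhd_stabiliser cantor_space thompson_V x)
      = nbhd_stabiliser cantor_space thompson_V y"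
    using homeomorphic_maps_imp_map[OF homeomorphic_maps_branch_swap] conjugate_nbhd_stabiliser_V
    by blast
qed

end
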